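(* Let $K$ be a field, let $\Gamma=(\Gamma_0,\Gamma_1,\mu,\mathfrak{o})$ be a Brauer configuration, and let $\Lambda=K\mathcal{Q}/I$ be the Brauer configuration algebra associated to $\Gamma$. Let $V,W\in\Gamma_1$ be polygons with $V\neq W$ (different as labeled polygons), and let $v$ and $w$ be the vertices of $\mathcal{Q}$ associated to $V$ and $W$ respectively. Let $\overline{V}=\Gamma_0\cap V$ and $\overline{W}=\Gamma_0\cap W$ be the underlying sets of vertices of $V$ and $W$. Then \[\dim_K v\Lambda w=\sum_{\alpha\in\overline{V}\cap\overline{W}}\mu(\alpha)\,\mathrm{occ}(\alpha,V)\,\mathrm{occ}(\alpha,W).\]
   Context: **Brauer configuration.** A Brauer configuration is a tuple $\Gamma=(\Gamma_0,\Gamma_1,\mu,\mathfrak{o})$ where: (1) $\Gamma_0$ is a finite set, whose elements are called vertices; (2) $\Gamma_1$ is a finite collection of finite labeled multisets of vertices, called polygons (two polygons with the same underlying multiset but different labels are different polygons); (3) $\mu:\Gamma_0\to\mathbb{Z}_{>0}$ is a function (the multiplicity function); (4) for $\alpha\in\Gamma_0$ and $V\in\Gamma_1$, $\mathrm{occ}(\alpha,V)$ is the number of times $\alpha$ appears in the multiset $V$, and $\mathrm{val}(\alpha)=\sum_{V\in\Gamma_1}\mathrm{occ}(\alpha,V)$. A vertex $\alpha$ is truncated if $\mathrm{val}(\alpha)=\mu(\alpha)=1$; $\mathcal{T}_\Gamma$ denotes the set of truncated vertices. The orientation $\mathfrak{o}$ is a choice, for each nontruncated vertex $\alpha$, of a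 cyclic ordering of the list of polygons containing $\alpha$, where each polygon $V$ is listed $\mathrm{occ}(\alpha,V)$ times (so the list has $t=\mathrm{val}(\alpha)$ entries). It is written $\alpha:V_{i_1}<\cdots<V_{i_t}$, with $V_{i_1}$ following $V_{i_t}$, and is considered up to cyclic permutation. It is further required that: every vertex lies in at least one polygon; every polygon has at least two vertices, counted with repetition; every polygon contains at least one vertex $\alpha$ with $\mathrm{val}(\alpha)\mu(\alpha)>1$. The intersection of a set and a multiset is the set of elements common to both, so $V\cap\Gamma_0$ is the underlying set of $V$. **Induced quiver $\mathcal{Q}$.** The vertices of $\mathcal{Q}$ are in bijection with the polygons; the vertex associated to $V$ is denoted $v$. For each nontruncated $\alpha$ with ordering $\alpha:V_{i_1}<\cdots<V_{i_t}$, $t=\mathrm{val}(\alpha)$, there are $t$ arrows $a^{(\alpha)}_l:v_{i_l}\to v_{i_{l+1}}$, $1\le l\le t$ (indices modulo $t$; if $t=1$ this is a single loop). Arrows coming from different $\alpha$ or different positions $l$ are distinct, and these are all the arrows of $\mathcal{Q}$. Paths are composed left to right. **Special cycles.** For nontruncated $\alpha$ and $1\le l\le t=\mathrm{val}(\alpha)$, the cycle $C_l=a^{(\alpha)}_l a^{(\alpha)}_{l+1}\cdots a^{(\alpha)}_t a^{(\alpha)}_1\cdots a^{(\alpha)}_{l-1}$ is a special $\alpha$-cycle. Those $C_l$ with $V_{i_l}=V$ are the special $\alpha$-cycles at $v$; there are $\mathrm{occ}(\alpha,V)$ of them. **Brauer configuration algebra.** $\Lambda=K\mathcal{Q}/I$,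 where $I$ is the two-sided ideal of the path algebra $K\mathcal{Q}$ generated by the following relations. Type one: $C^{\mu(\alpha)}-D^{\mu(\beta)}$, for every polygon $V$, all nontruncated vertices $\alpha,\beta\in V$ (possibly equal), every special $\alpha$-cycle $C$ at $v$ and every special $\beta$-cycle $D$ at $v$. Type two: $C^{\mu(\alpha)}f(C)$, for every nontruncated $\alpha$ and every special $\alpha$-cycle $C$, where $f(C)$ is the first arrow of $C$. Type three: all paths $ab$ of length two ($a,b$ arrows) such that $ab$ is not a subpath of any special cycle, except $ab=a^2$ where $a$ is the loop coming from a vertex $\alpha$ with $\mathrm{val}(\alpha)=1$ and $\mu(\alpha)>1$. For vertices $v,w$ of $\mathcal{Q}$, also regarded as the corresponding idempotents of $\Lambda$, $v\Lambda w$ is the $K$-subspace of $\Lambda$ spanned by the classes of the paths from $v$ to $w$. *)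

theory Defs
  imports
    "Graph_Theory.Arc_Walk"
    "HOL-Algebra.Embedded_Algebras"
    "HOL-Algebra.QuotRing"
    "HOL-Library.Poly_Mapping"
    "HOL-Library.Multiset"
    "HOL-Library.Sublist"
begin

section \<open>Path algebras\<close>

text \<open>
  A quiver is a directed multigraph.  A path is stored as (source, arcs, target), so that every
  vertex has its own trivial path \<open>(v, [], v)\<close>.  Paths are composed from left to right.
\<close>

type_synonym ('v, 'e) qpath = "'v \<times> 'e list \<times> 'v"

definition quiver_paths :: "('v, 'e) pre_digraph \<Rightarrow> ('v, 'e) qpath set" where
  "quiver_paths Q = {(u, p, v). pre_digraph.awalk Q u p v}"

definition arrow_path :: "('v, 'e) pre_digraph \<Rightarrow> 'e \<Rightarrow> ('v, 'e) qpath" where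
  "arrow_path Q a = (tail Q a, [a], head Q a)"

definition path_mult ::
  "(('v, 'e) qpath \<Rightarrow>\<^sub>0 'k::field) \<Rightarrow> (('v, 'e) qpath \<Rightarrow>\<^sub>0 'k) \<Rightarrow> (('v, 'e) qpath \<Rightarrow>\<^sub>0 'k)"
where
  "path_mult f g =
     (\<Sum>(u, p, v) \<in> Poly_Mapping.keys f. \<Sum>(v', q, w) \<in> Poly_Mapping.keys g.
        if v = v'
        then Poly_Mapping.single (u, p @ q, w)
               (Poly_Mapping.lookup f (u, p, v) * Poly_Mapping.lookup g (v', q, w))
        else 0)"

text \<open>The image of the scalar \<open>c\<close> in the path algebra: \<open>c\<close> times the sum of all trivial paths.\<close>

definition path_scalar :: "('v, 'e) pre_digraph \<Rightarrow> 'k::field \<Rightarrow> (('v, 'e) qpath \<Rightarrow>\<^sub>0 'k)" where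
  "path_scalar Q c = (\<Sum>v \<in> verts Q. Poly_Mapping.single (v, [], v) c)"

definition path_algebra :: "('v, 'e) pre_digraph \<Rightarrow> (('v, 'e) qpath \<Rightarrow>\<^sub>0 'k::field) ring" where
  "path_algebra Q =
     \<lparr>carrier = {f. Poly_Mapping.keys f \<subseteq> quiver_paths Q},
      monoid.mult = path_mult,
      one = path_scalar Q 1,
      zero = 0,
      add = (+)\<rparr>"

abbreviation path_elem :: "('v, 'e) qpath \<Rightarrow> (('v, 'e) qpath \<Rightarrow>\<^sub>0 'k::field)" where
  "path_elem p \<equiv> Poly_Mapping.single p 1"


section \<open>Brauer configurations\<close>

text \<open>A polygon is a labeled multiset of vertices, that is, a pair of a label and a multiset.\<close>

type_synonym ('a, 'l) polygon = "'l \<times> 'a multiset"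

text \<open>
  A cyclic ordering is given by a representing list.  Its value at truncated
  vertices (and outside the vertex set) is irrelevant.
\<close>

record ('a, 'l) brauer_config =
  vertices :: "'a set"
  polygons :: "('a, 'l) polygon set"
  mu :: "'a \<Rightarrow> nat"
  orientation :: "'a \<Rightarrow> ('a, 'l) polygon list"

definition occ :: "'a \<Rightarrow> ('a, 'l) polygon \<Rightarrow> nat" where
  "occ \<alpha> V = count (snd V) \<alpha>"

definition val :: "('a, 'l) brauer_config \<Rightarrow> 'a \<Rightarrow> nat" where
  "val \<Gamma> \<alpha> = (\<Sum>V \<in> polygons \<Gamma>. occ \<alpha> V)"

definition truncated :: "('a, 'l) brauer_config \<Rightarrow> 'a set" where
  "truncated \<Gamma> = {\<alpha> \<in> vertices \<Gamma>. val \<Gamma> \<alpha> = 1 \<and> mu \<Gamma> \<alpha> = 1}"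

definition nontruncated :: "('a, 'l) brauer_config \<Rightarrow> 'a set" where
  "nontruncated \<Gamma> = vertices \<Gamma> - truncated \<Gamma>"

locale brauer_configuration =
  fixes \<Gamma> :: "('a, 'l) brauer_config"
  assumes finite_vertices: "finite (vertices \<Gamma>)"
    and finite_polygons: "finite (polygons \<Gamma>)"
    and polygon_vertices: "V \<in> polygons \<Gamma> \<Longrightarrow> set_mset (snd V) \<subseteq> vertices \<Gamma>"
    and mu_pos: "\<alpha> \<in> vertices \<Gamma> \<Longrightarrow> mu \<Gamma> \<alpha> > 0"
    and orientation: "\<alpha> \<in> nontruncated \<Gamma> \<Longrightarrow>
      mset (orientation \<Gamma> \<alpha>) = (\<Sum>V \<in> polygons \<Gamma>. replicate_mset (occ \<alpha> V) V)"
    and vertex_in_polygon: "\<alpha> \<in> vertices \<Gamma> \<Longrightarrow> \<exists>V \<in> polygons \<Gamma>. \<alpha> \<in># snd V"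
    and polygon_size: "V \<in> polygons \<Gamma> \<Longrightarrow> size (snd V) \<ge> 2"
    and polygon_not_all_truncated:
      "V \<in> polygons \<Gamma> \<Longrightarrow> \<exists>\<alpha> \<in># snd V. val \<Gamma> \<alpha> * mu \<Gamma> \<alpha> > 1"


section \<open>The induced quiver and the Brauer configuration algebra\<close>

text \<open>
  The quiver vertex of a polygon is the polygon itself.  Positions in the ordering at \<open>\<alpha>\<close> are
  counted from \<open>0\<close>; the arrow leaving position \<open>l\<close> is the pair \<open>(\<alpha>, l)\<close>.
\<close>

type_synonym ('a, 'l) bc_path = "(('a, 'l) polygon, 'a \<times> nat) qpath"

definition induced_quiver :: "('a, 'l) brauer_config \<Rightarrow> (('a, 'l) polygon, 'a \<times> nat) pre_digraph"
where
  "induced_quiver \<Gamma> =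
     \<lparr>verts = polygons \<Gamma>,
      arcs = {(\<alpha>, l). \<alpha> \<in> nontruncated \<Gamma> \<and> l < val \<Gamma> \<alpha>},
      tail = (\<lambda>(\<alpha>, l). orientation \<Gamma> \<alpha> ! l),
      head = (\<lambda>(\<alpha>, l). orientation \<Gamma> \<alpha> ! (Suc l mod val \<Gamma> \<alpha>))\<rparr>"

abbreviation bc_path_algebra ::
  "('a, 'l) brauer_config \<Rightarrow> (('a, 'l) bc_path \<Rightarrow>\<^sub>0 'k::field) ring"
where
  "bc_path_algebra \<Gamma> \<equiv> path_algebra (induced_quiver \<Gamma>)"

definition special_cycle :: "('a, 'l) brauer_config \<Rightarrow> 'a \<Rightarrow> nat \<Rightarrow> ('a, 'l) bc_path" where
  "special_cycle \<Gamma> \<alpha> l =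
     (orientation \<Gamma> \<alpha> ! l,
      rotate l (map (\<lambda>i. (\<alpha>, i)) [0..<val \<Gamma> \<alpha>]),
      orientation \<Gamma> \<alpha> ! l)"

definition special_cycles_at ::
  "('a, 'l) brauer_config \<Rightarrow> 'a \<Rightarrow> ('a, 'l) polygon \<Rightarrow> ('a, 'l) bc_path set"
where
  "special_cycles_at \<Gamma> \<alpha> V =
     {special_cycle \<Gamma> \<alpha> l | l. l < val \<Gamma> \<alpha> \<and> orientation \<Gamma> \<alpha> ! l = V}"

definition special_cycles :: "('a, 'l) brauer_config \<Rightarrow> 'a \<Rightarrow> ('a, 'l) bc_path set" where
  "special_cycles \<Gamma> \<alpha> = {special_cycle \<Gamma> \<alpha> l | l. l < val \<Gamma> \<alpha>}"

definition first_arrow :: "('a, 'l) brauer_config \<Rightarrow> ('a, 'l) bc_path \<Rightarrow> ('a, 'l) bc_path" where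
  "first_arrow \<Gamma> C = arrow_path (induced_quiver \<Gamma>) (hd (fst (snd C)))"

definition relations_one :: "('a, 'l) brauer_config \<Rightarrow> (('a, 'l) bc_path \<Rightarrow>\<^sub>0 'k::field) set" where
  "relations_one \<Gamma> =
     {path_elem C [^]\<^bsub>bc_path_algebra \<Gamma>\<^esub> mu \<Gamma> \<alpha>
        \<ominus>\<^bsub>bc_path_algebra \<Gamma>\<^esub> path_elem D [^]\<^bsub>bc_path_algebra \<Gamma>\<^esub> mu \<Gamma> \<beta> | V \<alpha> \<beta> C D.
        V \<in> polygons \<Gamma> \<and>
        \<alpha> \<in> nontruncated \<Gamma> \<and> \<alpha> \<in># snd V \<and> C \<in> special_cycles_at \<Gamma> \<alpha> V \<and>
        \<beta> \<in> nontruncated \<Gamma> \<and> \<beta> \<in># snd V \<and> D \<in> special_cycles_at \<Gamma> \<beta> V}"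

definition relations_two :: "('a, 'l) brauer_config \<Rightarrow> (('a, 'l) bc_path \<Rightarrow>\<^sub>0 'k::field) set" where
  "relations_two \<Gamma> =
     {path_elem C [^]\<^bsub>bc_path_algebra \<Gamma>\<^esub> mu \<Gamma> \<alpha>
        \<otimes>\<^bsub>bc_path_algebra \<Gamma>\<^esub> path_elem (first_arrow \<Gamma> C) | \<alpha> C.
        \<alpha> \<in> nontruncated \<Gamma> \<and> C \<in> special_cycles \<Gamma> \<alpha>}"

definition relations_three :: "('a, 'l) brauer_config \<Rightarrow> (('a, 'l) bc_path \<Rightarrow>\<^sub>0 'k::field) set" where
  "relations_three \<Gamma> =
     {path_elem (u, [a, b], w) | u a b w.
        (u, [a, b], w) \<in> quiver_paths (induced_quiver \<Gamma>) \<and>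
        \<not> (\<exists>\<alpha> \<in> nontruncated \<Gamma>. \<exists>C \<in> special_cycles \<Gamma> \<alpha>. sublist [a, b] (fst (snd C))) \<and>
        \<not> (\<exists>\<alpha> \<in> nontruncated \<Gamma>. val \<Gamma> \<alpha> = 1 \<and> mu \<Gamma> \<alpha> > 1 \<and> a = (\<alpha>, 0) \<and> b = (\<alpha>, 0))}"

definition relation_ideal :: "('a, 'l) brauer_config \<Rightarrow> (('a, 'l) bc_path \<Rightarrow>\<^sub>0 'k::field) set" where
  "relation_ideal \<Gamma> =
     Idl\<^bsub>bc_path_algebra \<Gamma>\<^esub> (relations_one \<Gamma> \<union> relations_two \<Gamma> \<union> relations_three \<Gamma>)"

definition brauer_algebra ::
  "('a, 'l) brauer_config \<Rightarrow> (('a, 'l) bc_path \<Rightarrow>\<^sub>0 'k::field) set ring"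
where
  "brauer_algebra \<Gamma> = bc_path_algebra \<Gamma> Quot relation_ideal \<Gamma>"

definition residue_class ::
  "('a, 'l) brauer_config \<Rightarrow> (('a, 'l) bc_path \<Rightarrow>\<^sub>0 'k::field) \<Rightarrow> (('a, 'l) bc_path \<Rightarrow>\<^sub>0 'k) set"
where
  "residue_class \<Gamma> f = relation_ideal \<Gamma> +>\<^bsub>bc_path_algebra \<Gamma>\<^esub> f"

text \<open>
  The library's notions of span and dimension inside a ring refer to a subfield of that ring.  The
  base field (a type here) therefore enters through its image in the algebra, so that left
  multiplication by this image is the scalar multiplication.
\<close>

definition base_field ::
  "('a, 'l) brauer_config \<Rightarrow> (('a, 'l) bc_path \<Rightarrow>\<^sub>0 'k::field) set set"
where
  "base_field \<Gamma> = range (\<lambda>c. residue_class \<Gamma> (path_scalar (induced_quiver \<Gamma>) c))"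

text \<open>
  \<open>hom_space \<Gamma> V W\<close> is \<open>v\<Lambda>w\<close>: the span of the classes of all paths from \<open>v\<close> to \<open>w\<close>, which is the
  union of the spans of all finite lists of such classes.
\<close>

definition hom_space ::
  "('a, 'l) brauer_config \<Rightarrow> ('a, 'l) polygon \<Rightarrow> ('a, 'l) polygon
    \<Rightarrow> (('a, 'l) bc_path \<Rightarrow>\<^sub>0 'k::field) set set"
where
  "hom_space \<Gamma> V W =
     (\<Union>Us \<in> lists {residue_class \<Gamma> (path_elem (V, p, W)) | p.
                       (V, p, W) \<in> quiver_paths (induced_quiver \<Gamma>)}.
        ring.Span (brauer_algebra \<Gamma>) (base_field \<Gamma>) Us)"

end

(* Call a path a run if its arrows follow one another in a single cyclic ordering.  The relations of
   type three kill exactly the non-runs, those of type two the runs at \<alpha> longer than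
   mu(\<alpha>) val(\<alpha>), and those of type one identify closed runs of length exactly
   mu(\<alpha>) val(\<alpha>).  All relations therefore lie in the monomial ideal J (zero_ideal) spanned by the
   non-runs and the runs of length at least mu(\<alpha>) val(\<alpha>), so the remaining runs are
   linearly independent modulo the relations.  Between distinct polygons no run has length
   mu(\<alpha>) val(\<alpha>), so there every path in J is already zero, and the short runs form a
   basis.  A run at \<alpha> is given by its start position and its length, and among the
   lengths 0, ..., mu(\<alpha>) val(\<alpha>) - 1 every end position occurs mu(\<alpha>) times. *)

theory Submission
  imports Defs
begin

section \<open>Path algebras\<close>

text \<open>Elements are built up term by term along a finite set that contains the support.
  Carrying \<open>S\<close> through the step keeps every intermediate element in a prescribed space,
  for instance the span of the walks of a quiver.\<close>

lemma poly_mapping_support_induct [consumes 1, case_names zero add]: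
  fixes f :: "'a \<Rightarrow>\<^sub>0 'b::ab_group_add"
  assumes "Poly_Mapping.keys f \<subseteq> S"
    and zero: "P 0"
    and add: "\<And>x c g. x \<in> S \<Longrightarrow> Poly_Mapping.keys g \<subseteq> S \<Longrightarrow> P g \<Longrightarrow> P (Poly_Mapping.single x c + g)"
  shows "P f"
proof -
  have "P f" if "finite A" "A \<subseteq> S" "Poly_Mapping.keys f \<subseteq> A" for A f
    using that
  proof (induction A arbitrary: f rule: finite_induct)
    case empty
    then show ?case using zero by simp
  next
    case (insert x A)
    \<comment> \<open>Cancelling the coefficient at \<open>x\<close> brings the support into the
      smaller set, so the induction hypothesis applies to the remainder.\<close>
    let ?g = "f - Poly_Mapping.single x (Poly_Mapping.lookup f x)"
    have "Poly_Mapping.keys ?g \<subseteq> A"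
      using insert.prems
      by (auto simp: in_keys_iff lookup_minus lookup_single when_def split: if_splits)
    with insert have "P (Poly_Mapping.single x (Poly_Mapping.lookup f x) + ?g)"
      by (intro add insert.IH) auto
    then show ?case by simp
  qed
  from this[OF finite_keys assms(1) subset_refl] show ?thesis .
qed

lemma poly_mapping_single_induct [case_names zero add]:
  fixes f :: "'a \<Rightarrow>\<^sub>0 'b::ab_group_add"
  assumes "P 0" and "\<And>x c g. P g \<Longrightarrow> P (Poly_Mapping.single x c + g)"
  shows "P f"
  using subset_UNIV by (rule poly_mapping_support_induct) (rule assms)+

section \<open>Bilinearity and associativity of the product of paths\<close>

definition path_mult_single ::
  "('v, 'e) qpath \<Rightarrow> ('v, 'e) qpath \<Rightarrow> 'k::field \<Rightarrow> (('v, 'e) qpath \<Rightarrow>\<^sub>0 'k)"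
where
  "path_mult_single x y c =
     (if snd (snd x) = fst y
      then Poly_Mapping.single (fst x, fst (snd x) @ fst (snd y), snd (snd y)) c else 0)"

lemma path_mult_single_simps [simp]:
  "path_mult_single x y 0 = 0"
  "path_mult_single x y (c + d) = path_mult_single x y c + path_mult_single x y d"
  by (simp_all add: path_mult_single_def single_add)

text \<open>Pairs outside the supports carry the coefficient 0, so the double sum may run over
  larger finite sets. Additivity needs such common index sets, since the support of a sum can be
  smaller than the union of the supports.\<close>

lemma path_mult_superset:
  assumes "finite A" "finite B" "Poly_Mapping.keys f \<subseteq> A" "Poly_Mapping.keys g \<subseteq> B"
  shows "path_mult f g =
    (\<Sum>x\<in>A. \<Sum>y\<in>B. path_mult_single x y (Poly_Mapping.lookup f x * Poly_Mapping.lookup g y))"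
    (is "_ = ?rhs")
proof -
  have "path_mult f g = (\<Sum>x\<in>Poly_Mapping.keys f. \<Sum>y\<in>Poly_Mapping.keys g.
      path_mult_single x y (Poly_Mapping.lookup f x * Poly_Mapping.lookup g y))"
    unfolding path_mult_def path_mult_single_def
    by (auto intro!: sum.cong simp: case_prod_unfold)
  also have "\<dots> = (\<Sum>x\<in>Poly_Mapping.keys f. \<Sum>y\<in>B.
      path_mult_single x y (Poly_Mapping.lookup f x * Poly_Mapping.lookup g y))"
    using assms by (intro sum.cong sum.mono_neutral_left) (auto simp: in_keys_iff)
  also have "\<dots> = ?rhs"
    using assms by (intro sum.mono_neutral_left) (auto simp: in_keys_iff)
  finally show ?thesis .
qed

lemma path_mult_add_left: "path_mult (f + g) h = path_mult f h + path_mult g h"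
proof -
  let ?A = "Poly_Mapping.keys f \<union> Poly_Mapping.keys g"
  let ?B = "Poly_Mapping.keys h"
  have "Poly_Mapping.keys (f + g) \<subseteq> ?A"
    by (rule keys_add)
  then show ?thesis
    by (simp add: path_mult_superset[of ?A ?B] lookup_add distrib_right sum.distrib)
qed

lemma path_mult_add_right: "path_mult h (f + g) = path_mult h f + path_mult h g"
proof -
  let ?A = "Poly_Mapping.keys f \<union> Poly_Mapping.keys g"
  let ?B = "Poly_Mapping.keys h"
  have "Poly_Mapping.keys (f + g) \<subseteq> ?A"
    by (rule keys_add)
  then show ?thesis
    by (simp add: path_mult_superset[of ?B ?A] lookup_add distrib_left sum.distrib)
qed

lemma path_mult_zero [simp]: "path_mult 0 f = 0" "path_mult f 0 = 0"
  by (simp_all add: path_mult_def)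

lemma path_mult_sum_left: "path_mult (\<Sum>i\<in>I. f i) g = (\<Sum>i\<in>I. path_mult (f i) g)"
  by (induction I rule: infinite_finite_induct) (simp_all add: path_mult_add_left)

lemma path_mult_sum_right: "path_mult g (\<Sum>i\<in>I. f i) = (\<Sum>i\<in>I. path_mult g (f i))"
  by (induction I rule: infinite_finite_induct) (simp_all add: path_mult_add_right)

lemma path_mult_singles:
  "path_mult (Poly_Mapping.single (u, p, v) a) (Poly_Mapping.single (v', q, w) b) =
     (if v = v' then Poly_Mapping.single (u, p @ q, w) (a * b) else 0)"
  by (simp add: path_mult_superset[of "{(u, p, v)}" "{(v', q, w)}"] path_mult_single_def)

text \<open>Additivity in each argument reduces the claim to three single paths, where it is
  associativity of concatenation and of the product of coefficients. The three nested inductions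
  peel off one argument each.\<close>

lemma path_mult_assoc: "path_mult (path_mult f g) h = path_mult f (path_mult g h)"
proof (induction f rule: poly_mapping_single_induct)
  case (add x a f)
  have "path_mult (path_mult (Poly_Mapping.single x a) g) h
      = path_mult (Poly_Mapping.single x a) (path_mult g h)"
  proof (induction g rule: poly_mapping_single_induct)
    case (add y b g)
    have "path_mult (path_mult (Poly_Mapping.single x a) (Poly_Mapping.single y b)) h
      = path_mult (Poly_Mapping.single x a) (path_mult (Poly_Mapping.single y b) h)"
    proof (induction h rule: poly_mapping_single_induct)
      case (add z c h)
      have "path_mult (path_mult (Poly_Mapping.single x a) (Poly_Mapping.single y b))
           (Poly_Mapping.single z c) =
          path_mult (Poly_Mapping.single x a)
            (path_mult (Poly_Mapping.single y b) (Poly_Mapping.single z c))"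
        by (cases x; cases y; cases z) (simp add: path_mult_singles mult.assoc)
      then show ?case by (simp add: path_mult_add_right add.IH)
    qed simp
    then show ?case by (simp add: path_mult_add_left path_mult_add_right add.IH)
  qed simp
  then show ?case by (simp add: path_mult_add_left add.IH)
qed simp

text \<open>Equality fails in general: different pairs of paths may have the same concatenation, and
  their coefficients may cancel. Closure of the path algebra and the ideal property of
  \<open>zero_ideal\<close> both rest on this bound.\<close>

lemma keys_path_mult:
  "Poly_Mapping.keys (path_mult f g) \<subseteq>
     {(u, p @ q, w) | u p v q w. (u, p, v) \<in> Poly_Mapping.keys f \<and> (v, q, w) \<in> Poly_Mapping.keys g}"
    (is "_ \<subseteq> ?S")
proof -
  let ?t = "\<lambda>x y. path_mult_single x y (Poly_Mapping.lookup f x * Poly_Mapping.lookup g y)"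
  have "Poly_Mapping.keys (?t x y) \<subseteq> ?S"
    if "x \<in> Poly_Mapping.keys f" "y \<in> Poly_Mapping.keys g" for x y
    using that by (cases x; cases y) (auto simp: path_mult_single_def split: if_splits)
  then have "Poly_Mapping.keys (\<Sum>y\<in>Poly_Mapping.keys g. ?t x y) \<subseteq> ?S"
    if "x \<in> Poly_Mapping.keys f" for x
    using that by (intro order_trans[OF keys_sum]) blast
  then have "Poly_Mapping.keys (\<Sum>x\<in>Poly_Mapping.keys f. \<Sum>y\<in>Poly_Mapping.keys g. ?t x y) \<subseteq> ?S"
    by (intro order_trans[OF keys_sum]) blast
  then show ?thesis
    by (simp add: path_mult_superset[OF finite_keys finite_keys subset_refl subset_refl])
qed

lemma path_algebra_simps [simp]:
  "carrier (path_algebra Q) = {f. Poly_Mapping.keys f \<subseteq> quiver_paths Q}"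
  "f \<otimes>\<^bsub>path_algebra Q\<^esub> g = path_mult f g"
  "f \<oplus>\<^bsub>path_algebra Q\<^esub> g = f + g"
  "\<one>\<^bsub>path_algebra Q\<^esub> = path_scalar Q 1"
  "\<zero>\<^bsub>path_algebra Q\<^esub> = 0"
  by (simp_all add: path_algebra_def)

text \<open>Of all trivial paths only the one at the source composes with the given path. Finiteness
  of the vertex set matters because a sum over an infinite set is 0 by convention.\<close>

lemma path_scalar_mult_left:
  fixes c :: "'k::field"
  assumes "finite (verts Q)" "u \<in> verts Q"
  shows "path_mult (path_scalar Q c) (Poly_Mapping.single (u, p, v) a)
    = Poly_Mapping.single (u, p, v) (c * a)"
proof -
  have "path_mult (path_scalar Q c) (Poly_Mapping.single (u, p, v) a)
      = (\<Sum>x\<in>verts Q. if x = u then Poly_Mapping.single (x, p, v) (c * a) else 0)"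
    by (auto simp: path_scalar_def path_mult_sum_left path_mult_singles intro!: sum.cong)
  then show ?thesis using assms by simp
qed

lemma path_scalar_mult_right:
  fixes c :: "'k::field"
  assumes "finite (verts Q)" "v \<in> verts Q"
  shows "path_mult (Poly_Mapping.single (u, p, v) a) (path_scalar Q c)
    = Poly_Mapping.single (u, p, v) (a * c)"
proof -
  have "path_mult (Poly_Mapping.single (u, p, v) a) (path_scalar Q c)
      = (\<Sum>x\<in>verts Q. if v = x then Poly_Mapping.single (u, p, x) (a * c) else 0)"
    by (auto simp: path_scalar_def path_mult_sum_right path_mult_singles intro!: sum.cong)
  then show ?thesis using assms by simp
qed

section \<open>The ring structure of the path algebra\<close>

context wf_digraph
begin

lemma path_mult_closed:
  assumes "Poly_Mapping.keys f \<subseteq> quiver_paths G" "Poly_Mapping.keys g \<subseteq> quiver_paths G"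
  shows "Poly_Mapping.keys (path_mult f g) \<subseteq> quiver_paths G"
  using keys_path_mult[of f g] assms unfolding quiver_paths_def
  by (fastforce intro: awalk_appendI simp del: awalk_append_iff)

lemma path_scalar_closed: "Poly_Mapping.keys (path_scalar G c) \<subseteq> quiver_paths G"
  unfolding path_scalar_def
  by (intro order_trans[OF keys_sum]) (auto simp: quiver_paths_def awalk_Nil_iff split: if_splits)

lemma path_scalar_one_left:
  assumes "finite (verts G)" "Poly_Mapping.keys f \<subseteq> quiver_paths G"
  shows "path_mult (path_scalar G 1) f = f"
  using assms(2)
proof (induction f rule: poly_mapping_support_induct)
  case (add x c f)
  then show ?case
    using assms(1) by (cases x) (auto simp: path_mult_add_right path_scalar_mult_left quiver_paths_def)
qed simp

lemma path_scalar_one_right: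
  assumes "finite (verts G)" "Poly_Mapping.keys f \<subseteq> quiver_paths G"
  shows "path_mult f (path_scalar G 1) = f"
  using assms(2)
proof (induction f rule: poly_mapping_support_induct)
  case (add x c f)
  then show ?case
    using assms(1) by (cases x) (auto simp: path_mult_add_left path_scalar_mult_right quiver_paths_def)
qed simp

lemma ring_path_algebra:
  assumes "finite (verts G)"
  shows "ring (path_algebra G :: (('a, 'b) qpath \<Rightarrow>\<^sub>0 'k::field) ring)" (is "ring ?R")
proof (rule ringI)
  show "abelian_group ?R"
  proof (rule abelian_groupI)
    fix f assume "f \<in> carrier ?R"
    then show "\<exists>g\<in>carrier ?R. g \<oplus>\<^bsub>?R\<^esub> f = \<zero>\<^bsub>?R\<^esub>"
      by (intro bexI[of _ "- f"]) auto
  qed (use keys_add in \<open>fastforce simp: add.assoc add.commute\<close>)+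
  show "monoid ?R"
    by (rule monoidI)
      (auto simp: path_mult_assoc path_scalar_one_left[OF assms] path_scalar_one_right[OF assms]
        intro: path_mult_closed[THEN subsetD] path_scalar_closed[THEN subsetD])
qed (simp_all add: path_mult_add_left path_mult_add_right)

lemma path_algebra_minus:
  assumes "finite (verts G)" "Poly_Mapping.keys f \<subseteq> quiver_paths G"
    "Poly_Mapping.keys g \<subseteq> quiver_paths G"
  shows "\<ominus>\<^bsub>path_algebra G\<^esub> f = - f" "g \<ominus>\<^bsub>path_algebra G\<^esub> f = g - f"
proof -
  interpret ring "path_algebra G :: (('a, 'b) qpath \<Rightarrow>\<^sub>0 'c) ring"
    by (rule ring_path_algebra[OF assms(1)])
  show "\<ominus>\<^bsub>path_algebra G\<^esub> f = - f"
    by (rule minus_equality) (use assms in simp_all)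
  then show "g \<ominus>\<^bsub>path_algebra G\<^esub> f = g - f"
    by (simp add: a_minus_def)
qed

lemma path_power:
  assumes "finite (verts G)" "(u, p, u) \<in> quiver_paths G" "n > 0"
  shows "path_elem (u, p, u) [^]\<^bsub>path_algebra G\<^esub> n
    = (path_elem (u, concat (replicate n p), u) :: ('a, 'b) qpath \<Rightarrow>\<^sub>0 'k::field)"
proof -
  let ?R = "path_algebra G :: (('a, 'b) qpath \<Rightarrow>\<^sub>0 'k) ring"
  interpret ring ?R
    by (rule ring_path_algebra[OF assms(1)])
  \<comment> \<open>The induction starts at the first power: the zeroth power is the unit, that is,
    the sum of all trivial paths and not just the one at \<open>u\<close>.\<close>
  have "path_elem (u, p, u) [^]\<^bsub>?R\<^esub> Suc m = path_elem (u, concat (replicate (Suc m) p), u)" for m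
  proof (induction m)
    case 0
    then show ?case
      using assms by (simp add: path_scalar_one_left)
  next
    case (Suc m)
    have "path_elem (u, p, u) [^]\<^bsub>?R\<^esub> Suc (Suc m)
      = path_mult (path_elem (u, p, u) [^]\<^bsub>?R\<^esub> Suc m) (path_elem (u, p, u))"
      by simp
    \<comment> \<open>Powers grow on the right while \<open>replicate\<close> grows on the left; the
      two forms agree because all blocks are equal.\<close>
    also have "\<dots> = path_elem (u, concat (replicate (Suc m) p @ [p]), u)"
      unfolding Suc.IH by (simp add: path_mult_singles)
    finally show ?case
      by (simp only: replicate_append_same replicate_Suc append_Cons)
  qed
  from this[of "n - 1"] assms(3) show ?thesis by simp
qed

end

section \<open>Runs of consecutive arrows\<close>

text \<open>During one period the residues of \<open>l + n\<close> run through every position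
  exactly once, whatever the offset \<open>l\<close>, so \<open>m\<close> periods meet each position
  \<open>m\<close> times. This is the origin of the factor \<open>mu \<Gamma> \<alpha>\<close> in
  the dimension formula.\<close>

lemma card_periodic:
  fixes t :: nat
  shows "card {n. n < m * t \<and> P ((l + n) mod t)} = m * card {i. i < t \<and> P i}"
proof (induction m)
  case (Suc m)
  let ?A = "{n. n < t \<and> P ((l + n) mod t)}"
  \<comment> \<open>Reading one period from the offset \<open>l\<close> amounts to rotating the list
    of positions, and a rotation leaves its set of entries unchanged.\<close>
  have "card ?A = length (filter P (rotate l [0..<t]))"
    by (auto simp: length_filter_conv_card nth_rotate intro!: arg_cong[where f = card])
  also have "\<dots> = card (set (filter P (rotate l [0..<t])))"
    by (simp only: distinct_card distinct_filter distinct_rotate distinct_upt)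
  also have "set (filter P (rotate l [0..<t])) = {i. i < t \<and> P i}"
    by auto
  finally have base: "card ?A = card {i. i < t \<and> P i}" .
  \<comment> \<open>The last period is split off; its shift by \<open>m * t\<close> does not affect
    residues.\<close>
  have "{n. n < Suc m * t \<and> P ((l + n) mod t)}
    = {n. n < m * t \<and> P ((l + n) mod t)} \<union> (\<lambda>n. m * t + n) ` ?A" (is "?L = ?M \<union> ?N")
  proof (rule Set.set_eqI)
    fix n
    show "n \<in> ?L \<longleftrightarrow> n \<in> ?M \<union> ?N"
    proof (cases "n < m * t")
      case False
      then obtain k where "n = m * t + k"
        by (metis le_Suc_ex not_less)
      then show ?thesis by (auto simp: add.left_commute[of l])
    qed auto
  qed
  moreover have "?M \<inter> ?N = {}"
    by auto
  ultimately show ?case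
    using base Suc.IH by (simp add: card_Un_disjoint card_image)
qed simp

text \<open>Reduction modulo the valency closes the ordering up to a cycle. At valency 1 the loop is
  its own successor.\<close>

definition next_arrow :: "('a, 'l) brauer_config \<Rightarrow> 'a \<times> nat \<Rightarrow> 'a \<times> nat" where
  "next_arrow \<Gamma> = (\<lambda>(\<alpha>, l). (\<alpha>, Suc l mod val \<Gamma> \<alpha>))"

definition consecutive :: "('a, 'l) brauer_config \<Rightarrow> ('a \<times> nat) list \<Rightarrow> bool" where
  "consecutive \<Gamma> = successively (\<lambda>a b. b = next_arrow \<Gamma> a)"

text \<open>Positions are reduced arrow by arrow, so \<open>l\<close> may exceed the valency. A run
  can therefore be cut anywhere, the remainder being a run with a shifted start.\<close>

definition run :: "('a, 'l) brauer_config \<Rightarrow> 'a \<Rightarrow> nat \<Rightarrow> nat \<Rightarrow> ('a \<times> nat) list" where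
  "run \<Gamma> \<alpha> l n = map (\<lambda>i. (\<alpha>, (l + i) mod val \<Gamma> \<alpha>)) [0..<n]"

text \<open>The bound is not strict, so that powers of special cycles are included: type one
  relations are differences of these. Trivial paths are excluded explicitly, as they have no first
  arrow.\<close>

definition zero_walk :: "('a, 'l) brauer_config \<Rightarrow> ('a \<times> nat) list \<Rightarrow> bool" where
  "zero_walk \<Gamma> p \<longleftrightarrow> \<not> consecutive \<Gamma> p \<or>
     p \<noteq> [] \<and> mu \<Gamma> (fst (hd p)) * val \<Gamma> (fst (hd p)) \<le> length p"

lemma length_run [simp]: "length (run \<Gamma> \<alpha> l n) = n"
  by (simp add: run_def)

lemma run_0 [simp]: "run \<Gamma> \<alpha> l 0 = []"
  by (simp add: run_def)

lemma run_Suc: "run \<Gamma> \<alpha> l (Suc n) = run \<Gamma> \<alpha> l n @ [(\<alpha>, (l + n) mod val \<Gamma> \<alpha>)]"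
  by (simp add: run_def)

lemma nth_run: "i < n \<Longrightarrow> run \<Gamma> \<alpha> l n ! i = (\<alpha>, (l + i) mod val \<Gamma> \<alpha>)"
  by (simp add: run_def)

lemma run_eq_Nil [simp]: "run \<Gamma> \<alpha> l n = [] \<longleftrightarrow> n = 0"
  by (simp add: run_def)

lemma hd_run: "n > 0 \<Longrightarrow> hd (run \<Gamma> \<alpha> l n) = (\<alpha>, l mod val \<Gamma> \<alpha>)"
  by (simp add: hd_conv_nth nth_run)

lemma run_add: "run \<Gamma> \<alpha> l (m + n) = run \<Gamma> \<alpha> l m @ run \<Gamma> \<alpha> (l + m) n"
  by (induction n) (simp_all add: run_Suc add.assoc)

lemma run_shift_val: "run \<Gamma> \<alpha> (l + val \<Gamma> \<alpha>) n = run \<Gamma> \<alpha> l n"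
  by (simp add: run_def add.assoc add.left_commute[of l "val \<Gamma> \<alpha>"])

lemma concat_replicate_run:
  "concat (replicate n (run \<Gamma> \<alpha> l (val \<Gamma> \<alpha>))) = run \<Gamma> \<alpha> l (n * val \<Gamma> \<alpha>)"
  by (induction n) (simp_all add: run_add run_shift_val)

lemma consecutive_run: "consecutive \<Gamma> (run \<Gamma> \<alpha> l n)"
  by (simp add: consecutive_def successively_conv_nth nth_run next_arrow_def mod_Suc_eq)

text \<open>Every arrow has a single successor, so the first arrow and the length determine the
  whole path.\<close>

lemma consecutive_eq_run:
  assumes "consecutive \<Gamma> p" "p \<noteq> []" "hd p = (\<alpha>, l)" "l < val \<Gamma> \<alpha>"
  shows "p = run \<Gamma> \<alpha> l (length p)"
proof (rule nth_equalityI)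
  show "p ! i = run \<Gamma> \<alpha> l (length p) ! i" if "i < length p" for i
    using that
  proof (induction i)
    case 0
    then show ?case using assms by (simp add: nth_run hd_conv_nth)
  next
    case (Suc i)
    then have "p ! Suc i = next_arrow \<Gamma> (p ! i)"
      using assms(1) by (simp add: consecutive_def successively_conv_nth)
    with Suc show ?case by (simp add: nth_run next_arrow_def mod_Suc_eq)
  qed
qed simp

lemma consecutive_fst:
  assumes "consecutive \<Gamma> p" "a \<in> set p"
  shows "fst a = fst (hd p)"
proof -
  have "i < length p \<Longrightarrow> fst (p ! i) = fst (p ! 0)" for i
    using assms(1)
    by (induction i) (auto simp: consecutive_def successively_conv_nth next_arrow_def split: prod.splits)
  with assms(2) show ?thesis
    by (metis in_set_conv_nth hd_conv_nth list.size(3) not_less_zero)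
qed

text \<open>Prepending arrows changes the head of the list, but if the result is still consecutive
  then all its arrows belong to the same vertex. The length bound is then unchanged, while the
  length can only grow.\<close>

lemma zero_walk_append_left:
  assumes "zero_walk \<Gamma> q"
  shows "zero_walk \<Gamma> (p @ q)"
proof (cases "consecutive \<Gamma> (p @ q)")
  case True
  then have "consecutive \<Gamma> q"
    by (simp add: consecutive_def successively_append_iff)
  with assms have "q \<noteq> []" "mu \<Gamma> (fst (hd q)) * val \<Gamma> (fst (hd q)) \<le> length q"
    by (simp_all add: zero_walk_def)
  moreover from \<open>q \<noteq> []\<close> have "fst (hd (p @ q)) = fst (hd q)"
    using consecutive_fst[OF True, of "hd q"] by simp
  ultimately show ?thesis by (simp add: zero_walk_def)
qed (simp add: zero_walk_def)

lemma zero_walk_append_right: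
  assumes "zero_walk \<Gamma> p"
  shows "zero_walk \<Gamma> (p @ q)"
  using assms by (auto simp: zero_walk_def consecutive_def successively_append_iff)

lemma zero_walk_run:
  assumes "val \<Gamma> \<alpha> > 0" "n > 0"
  shows "zero_walk \<Gamma> (run \<Gamma> \<alpha> l n) \<longleftrightarrow> mu \<Gamma> \<alpha> * val \<Gamma> \<alpha> \<le> n"
  using assms by (simp add: zero_walk_def consecutive_run hd_run)

lemma special_cycle_eq_run:
  assumes "l < val \<Gamma> \<alpha>"
  shows "special_cycle \<Gamma> \<alpha> l
    = (orientation \<Gamma> \<alpha> ! l, run \<Gamma> \<alpha> l (val \<Gamma> \<alpha>), orientation \<Gamma> \<alpha> ! l)"
  unfolding special_cycle_def by (auto intro!: nth_equalityI simp: nth_rotate nth_run)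

lemma induced_quiver_simps [simp]:
  "verts (induced_quiver \<Gamma>) = polygons \<Gamma>"
  "(\<alpha>, l) \<in> arcs (induced_quiver \<Gamma>) \<longleftrightarrow> \<alpha> \<in> nontruncated \<Gamma> \<and> l < val \<Gamma> \<alpha>"
  "tail (induced_quiver \<Gamma>) (\<alpha>, l) = orientation \<Gamma> \<alpha> ! l"
  "head (induced_quiver \<Gamma>) (\<alpha>, l) = orientation \<Gamma> \<alpha> ! (Suc l mod val \<Gamma> \<alpha>)"
  by (simp_all add: induced_quiver_def)

section \<open>Arrows and walks in the quiver of a Brauer configuration\<close>

context brauer_configuration
begin

lemma count_orientation:
  assumes "\<alpha> \<in> nontruncated \<Gamma>"
  shows "count (mset (orientation \<Gamma> \<alpha>)) V = (if V \<in> polygons \<Gamma> then occ \<alpha> V else 0)"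
  unfolding orientation[OF assms] using finite_polygons by (simp add: count_sum)

lemma length_orientation:
  assumes "\<alpha> \<in> nontruncated \<Gamma>"
  shows "length (orientation \<Gamma> \<alpha>) = val \<Gamma> \<alpha>"
  unfolding size_mset[symmetric] orientation[OF assms] val_def
  using finite_polygons by (induction rule: finite_induct) auto

lemma orientation_in_polygons:
  assumes "\<alpha> \<in> nontruncated \<Gamma>" "l < val \<Gamma> \<alpha>"
  shows "orientation \<Gamma> \<alpha> ! l \<in> polygons \<Gamma>"
  using assms count_orientation[OF assms(1), of "orientation \<Gamma> \<alpha> ! l"] length_orientation[OF assms(1)]
  by (metis count_eq_zero_iff nth_mem set_mset_mset)

lemma val_pos:
  assumes "\<alpha> \<in> vertices \<Gamma>"
  shows "val \<Gamma> \<alpha> > 0"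
  using vertex_in_polygon[OF assms] finite_polygons by (auto simp: val_def occ_def sum_pos2)

lemma nontruncated_pos:
  assumes "\<alpha> \<in> nontruncated \<Gamma>"
  shows "val \<Gamma> \<alpha> > 0" "mu \<Gamma> \<alpha> > 0"
  using assms val_pos mu_pos by (auto simp: nontruncated_def)

lemma wf_induced_quiver: "wf_digraph (induced_quiver \<Gamma>)"
  using orientation_in_polygons nontruncated_pos by unfold_locales auto

sublocale quiver: wf_digraph "induced_quiver \<Gamma>"
  by (rule wf_induced_quiver)

lemma finite_quiver_verts: "finite (verts (induced_quiver \<Gamma>))"
  by (simp add: finite_polygons)

lemma awalk_run:
  assumes "\<alpha> \<in> nontruncated \<Gamma>" "l < val \<Gamma> \<alpha>"
  shows "quiver.awalk (orientation \<Gamma> \<alpha> ! l) (run \<Gamma> \<alpha> l n) (orientation \<Gamma> \<alpha> ! ((l + n) mod val \<Gamma> \<alpha>))"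
proof (induction n)
  case 0
  then show ?case using assms by (simp add: quiver.awalk_Nil_iff orientation_in_polygons)
next
  case (Suc n)
  let ?a = "(\<alpha>, (l + n) mod val \<Gamma> \<alpha>)"
  have "quiver.awalk (tail (induced_quiver \<Gamma>) ?a) [?a] (head (induced_quiver \<Gamma>) ?a)"
    using assms by (intro quiver.arc_implies_awalk) auto
  with Suc show ?case
    by (auto simp: run_Suc mod_Suc_eq intro: quiver.awalk_appendI simp del: quiver.awalk_append_iff)
qed

text \<open>Since the ends differ, the path is nonempty, and its first arrow names the vertex and
  the starting position of the run.\<close>

lemma consecutive_walkE:
  assumes "quiver.awalk V p W" "consecutive \<Gamma> p" "V \<noteq> W"
  obtains \<alpha> l n where "p = run \<Gamma> \<alpha> l n" "\<alpha> \<in> nontruncated \<Gamma>" "l < val \<Gamma> \<alpha>" "n > 0"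
    "V = orientation \<Gamma> \<alpha> ! l" "W = orientation \<Gamma> \<alpha> ! ((l + n) mod val \<Gamma> \<alpha>)"
proof -
  from assms(1,3) obtain \<alpha> l where p: "p \<noteq> []" "hd p = (\<alpha>, l)" "\<alpha> \<in> nontruncated \<Gamma>" "l < val \<Gamma> \<alpha>"
    by (cases p) (auto simp: quiver.awalk_Nil_iff quiver.awalk_Cons_iff)
  define n where "n = length p"
  have run: "p = run \<Gamma> \<alpha> l n"
    unfolding n_def by (rule consecutive_eq_run[OF assms(2) p(1,2,4)])
  moreover have "n > 0"
    using p(1) by (simp add: n_def)
  \<comment> \<open>A nonempty list of arrows determines both ends of its walk, so these can be read
    off from \<open>awalk_run\<close>.\<close>
  ultimately show ?thesis
    using that[OF run p(3,4)] quiver.awalk_ends[OF assms(1)[unfolded run] awalk_run[OF p(3,4)]] by simp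
qed

section \<open>The monomial ideal of zero walks\<close>

definition zero_ideal :: "(('a, 'l) bc_path \<Rightarrow>\<^sub>0 'k::field) set" where
  "zero_ideal = {f. Poly_Mapping.keys f \<subseteq>
     {(u, p, v). (u, p, v) \<in> quiver_paths (induced_quiver \<Gamma>) \<and> zero_walk \<Gamma> p}}"

lemma ring_bc_path_algebra:
  "ring (bc_path_algebra \<Gamma> :: (('a, 'l) bc_path \<Rightarrow>\<^sub>0 'k::field) ring)"
  by (rule quiver.ring_path_algebra[OF finite_quiver_verts])

text \<open>The additive closure properties hold because membership is a condition on supports.
  Closure under products holds because a zero walk stays one when extended on either side.\<close>

lemma ideal_zero_ideal:
  "ideal zero_ideal (bc_path_algebra \<Gamma> :: (('a, 'l) bc_path \<Rightarrow>\<^sub>0 'k::field) ring)"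
    (is "ideal _ ?R")
proof -
  interpret R: ring ?R by (rule ring_bc_path_algebra)
  have sub: "zero_ideal \<subseteq> carrier ?R"
    by (auto simp: zero_ideal_def)
  have mult: "path_mult x a \<in> zero_ideal" "path_mult a x \<in> zero_ideal"
    if "a \<in> zero_ideal" "x \<in> carrier ?R" for a x :: "('a, 'l) bc_path \<Rightarrow>\<^sub>0 'k"
  proof -
    have "path_mult x a \<in> carrier ?R" "path_mult a x \<in> carrier ?R"
      using that sub R.m_closed[of x a] R.m_closed[of a x] by auto
    moreover have "zero_walk \<Gamma> p" if "(u, p, v) \<in> Poly_Mapping.keys (path_mult x a)" for u p v
      using subsetD[OF keys_path_mult that] \<open>a \<in> zero_ideal\<close>
      by (auto simp: zero_ideal_def intro: zero_walk_append_left)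
    moreover have "zero_walk \<Gamma> p" if "(u, p, v) \<in> Poly_Mapping.keys (path_mult a x)" for u p v
      using subsetD[OF keys_path_mult that] \<open>a \<in> zero_ideal\<close>
      by (auto simp: zero_ideal_def intro: zero_walk_append_right)
    ultimately show "path_mult x a \<in> zero_ideal" "path_mult a x \<in> zero_ideal"
      by (auto simp: zero_ideal_def)
  qed
  show ?thesis
  proof (rule idealI)
    show "subgroup zero_ideal (add_monoid ?R)"
    proof (rule R.add.subgroupI)
      show "zero_ideal \<noteq> {}"
        by (auto simp: zero_ideal_def intro: exI[of _ 0])
      show "\<ominus>\<^bsub>?R\<^esub> a \<in> zero_ideal" if "a \<in> zero_ideal" for a
      proof -
        have "\<ominus>\<^bsub>?R\<^esub> a = - a"
          using that sub by (intro quiver.path_algebra_minus(1)[OF finite_quiver_verts, of a a]) auto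
        with that show ?thesis
          by (simp add: zero_ideal_def)
      qed
      show "a \<oplus>\<^bsub>?R\<^esub> b \<in> zero_ideal" if "a \<in> zero_ideal" "b \<in> zero_ideal" for a b
        using that keys_add[of a b] by (auto simp: zero_ideal_def)
    qed (use sub in simp)
  qed (use mult ring_bc_path_algebra in auto)
qed

section \<open>All three types of relations lie in the monomial ideal\<close>

lemma run_in_quiver_paths:
  assumes "\<alpha> \<in> nontruncated \<Gamma>" "l < val \<Gamma> \<alpha>"
  shows "(orientation \<Gamma> \<alpha> ! l, run \<Gamma> \<alpha> l n, orientation \<Gamma> \<alpha> ! ((l + n) mod val \<Gamma> \<alpha>))
    \<in> quiver_paths (induced_quiver \<Gamma>)"
  using awalk_run[OF assms] by (simp add: quiver_paths_def)

lemma special_cycle_power: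
  assumes "\<alpha> \<in> nontruncated \<Gamma>" "l < val \<Gamma> \<alpha>"
  shows "(path_elem (special_cycle \<Gamma> \<alpha> l) :: ('a, 'l) bc_path \<Rightarrow>\<^sub>0 'k::field)
      [^]\<^bsub>bc_path_algebra \<Gamma>\<^esub> mu \<Gamma> \<alpha> =
    path_elem (orientation \<Gamma> \<alpha> ! l, run \<Gamma> \<alpha> l (mu \<Gamma> \<alpha> * val \<Gamma> \<alpha>), orientation \<Gamma> \<alpha> ! l)"
  using assms run_in_quiver_paths[OF assms, of "val \<Gamma> \<alpha>"] nontruncated_pos[OF assms(1)]
  by (simp add: special_cycle_eq_run quiver.path_power finite_polygons concat_replicate_run)

text \<open>The power is a run whose length meets the bound in \<open>zero_walk\<close> with
  equality.\<close>

lemma special_cycle_power_in_zero_ideal: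
  assumes "\<alpha> \<in> nontruncated \<Gamma>" "l < val \<Gamma> \<alpha>"
  shows "(path_elem (special_cycle \<Gamma> \<alpha> l) :: ('a, 'l) bc_path \<Rightarrow>\<^sub>0 'k::field)
      [^]\<^bsub>bc_path_algebra \<Gamma>\<^esub> mu \<Gamma> \<alpha> \<in> zero_ideal"
  unfolding special_cycle_power[OF assms]
  using assms run_in_quiver_paths[OF assms, of "mu \<Gamma> \<alpha> * val \<Gamma> \<alpha>"] nontruncated_pos[OF assms(1)]
  by (simp add: zero_ideal_def zero_walk_run)

lemma first_arrow_special_cycle:
  assumes "l < val \<Gamma> \<alpha>"
  shows "first_arrow \<Gamma> (special_cycle \<Gamma> \<alpha> l)
    = (orientation \<Gamma> \<alpha> ! l, [(\<alpha>, l)], orientation \<Gamma> \<alpha> ! (Suc l mod val \<Gamma> \<alpha>))"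
proof -
  have "hd (run \<Gamma> \<alpha> l (val \<Gamma> \<alpha>)) = (\<alpha>, l)"
    using assms by (simp add: hd_run)
  then show ?thesis
    using assms by (simp add: first_arrow_def special_cycle_eq_run arrow_path_def)
qed

text \<open>Each of the two powers lies in the ideal by itself, hence so does their
  difference.\<close>

lemma relations_one_in_zero_ideal:
  "relations_one \<Gamma> \<subseteq> (zero_ideal :: (('a, 'l) bc_path \<Rightarrow>\<^sub>0 'k::field) set)"
proof -
  interpret ideal zero_ideal "bc_path_algebra \<Gamma> :: (('a, 'l) bc_path \<Rightarrow>\<^sub>0 'k) ring"
    by (rule ideal_zero_ideal)
  show ?thesis
    unfolding relations_one_def special_cycles_at_def a_minus_def
    by (auto intro!: additive_subgroup.a_closed[OF additive_subgroup_axioms]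
        additive_subgroup.a_inv_closed[OF additive_subgroup_axioms]
        special_cycle_power_in_zero_ideal simp del: path_algebra_simps)
qed

lemma relations_two_in_zero_ideal:
  "relations_two \<Gamma> \<subseteq> (zero_ideal :: (('a, 'l) bc_path \<Rightarrow>\<^sub>0 'k::field) set)"
proof -
  interpret ideal zero_ideal "bc_path_algebra \<Gamma> :: (('a, 'l) bc_path \<Rightarrow>\<^sub>0 'k) ring"
    by (rule ideal_zero_ideal)
  have "path_elem (first_arrow \<Gamma> (special_cycle \<Gamma> \<alpha> l)) \<in>
      carrier (bc_path_algebra \<Gamma> :: (('a, 'l) bc_path \<Rightarrow>\<^sub>0 'k) ring)"
    if "\<alpha> \<in> nontruncated \<Gamma>" "l < val \<Gamma> \<alpha>" for \<alpha> l
    using run_in_quiver_paths[OF that, of 1] that(2)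
    by (simp add: first_arrow_special_cycle run_def)
  then show ?thesis
    unfolding relations_two_def special_cycles_def
    by (auto intro!: I_r_closed special_cycle_power_in_zero_ideal simp del: path_algebra_simps)
qed

text \<open>With valency at least 2, a full turn from \<open>l\<close> begins with the two arrows in
  question. At valency 1 a turn is a single loop without subpaths of length two, which is why the
  type three relations need their exception.\<close>

lemma sublist_special_cycle:
  assumes "\<alpha> \<in> nontruncated \<Gamma>" "l < val \<Gamma> \<alpha>" "val \<Gamma> \<alpha> \<noteq> 1"
  shows "sublist [(\<alpha>, l), next_arrow \<Gamma> (\<alpha>, l)] (fst (snd (special_cycle \<Gamma> \<alpha> l)))"
proof -
  have "run \<Gamma> \<alpha> l (val \<Gamma> \<alpha>) = run \<Gamma> \<alpha> l 2 @ run \<Gamma> \<alpha> (l + 2) (val \<Gamma> \<alpha> - 2)"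
    using assms(3) nontruncated_pos(1)[OF assms(1)] run_add[of \<Gamma> \<alpha> l 2 "val \<Gamma> \<alpha> - 2"]
    by (simp add: numeral_2_eq_2 Suc_diff_Suc)
  moreover have "run \<Gamma> \<alpha> l 2 = [(\<alpha>, l), next_arrow \<Gamma> (\<alpha>, l)]"
    using assms(2) by (simp add: run_def upt_rec next_arrow_def)
  ultimately show ?thesis
    using assms(2) by (simp add: special_cycle_eq_run)
qed

lemma relations_three_in_zero_ideal:
  "relations_three \<Gamma> \<subseteq> (zero_ideal :: (('a, 'l) bc_path \<Rightarrow>\<^sub>0 'k::field) set)"
proof
  fix f :: "('a, 'l) bc_path \<Rightarrow>\<^sub>0 'k"
  assume "f \<in> relations_three \<Gamma>"
  then obtain u \<alpha> l b w where f: "f = path_elem (u, [(\<alpha>, l), b], w)"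
    and path: "(u, [(\<alpha>, l), b], w) \<in> quiver_paths (induced_quiver \<Gamma>)"
    and cycle: "\<And>\<beta> C. \<beta> \<in> nontruncated \<Gamma> \<Longrightarrow> C \<in> special_cycles \<Gamma> \<beta> \<Longrightarrow>
        \<not> sublist [(\<alpha>, l), b] (fst (snd C))"
    and loop: "\<And>\<beta>. \<beta> \<in> nontruncated \<Gamma> \<Longrightarrow> val \<Gamma> \<beta> = 1 \<Longrightarrow> mu \<Gamma> \<beta> > 1 \<Longrightarrow>
        \<not> ((\<alpha>, l) = (\<beta>, 0) \<and> b = (\<beta>, 0))"
    unfolding relations_three_def by fast
  from path have \<alpha>: "\<alpha> \<in> nontruncated \<Gamma>" and l: "l < val \<Gamma> \<alpha>"
    by (auto simp: quiver_paths_def quiver.awalk_Cons_iff)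
  \<comment> \<open>If the second arrow followed the first, the pair would be either a subpath of a
    special cycle or the excepted square of a loop. At valency 1, being nontruncated forces
    multiplicity above 1, so the exception really applies.\<close>
  have "b \<noteq> next_arrow \<Gamma> (\<alpha>, l)"
  proof (cases "val \<Gamma> \<alpha> = 1")
    case True
    with \<alpha> have "mu \<Gamma> \<alpha> \<noteq> 1"
      by (auto simp: nontruncated_def truncated_def)
    with nontruncated_pos[OF \<alpha>] have "mu \<Gamma> \<alpha> > 1"
      by simp
    with loop[OF \<alpha> True] l True show ?thesis
      by (auto simp: next_arrow_def)
  next
    case False
    moreover have "special_cycle \<Gamma> \<alpha> l \<in> special_cycles \<Gamma> \<alpha>"
      using l unfolding special_cycles_def by blast
    ultimately show ?thesis
      using cycle[OF \<alpha>] sublist_special_cycle[OF \<alpha> l] by blast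
  qed
  with path show "f \<in> zero_ideal"
    by (simp add: f zero_ideal_def zero_walk_def consecutive_def)
qed

text \<open>The generated ideal behaves as expected only for generators in the ring. That they are
  walks comes for free from their membership in \<open>zero_ideal\<close>.\<close>

lemma relations_in_carrier:
  "relations_one \<Gamma> \<union> relations_two \<Gamma> \<union> relations_three \<Gamma> \<subseteq>
    carrier (bc_path_algebra \<Gamma> :: (('a, 'l) bc_path \<Rightarrow>\<^sub>0 'k::field) ring)"
proof -
  have "zero_ideal \<subseteq> carrier (bc_path_algebra \<Gamma> :: (('a, 'l) bc_path \<Rightarrow>\<^sub>0 'k) ring)"
    by (auto simp: zero_ideal_def)
  then show ?thesis
    using relations_one_in_zero_ideal relations_two_in_zero_ideal relations_three_in_zero_ideal by blast
qed

lemma ideal_relation_ideal: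
  "ideal (relation_ideal \<Gamma>) (bc_path_algebra \<Gamma> :: (('a, 'l) bc_path \<Rightarrow>\<^sub>0 'k::field) ring)"
  unfolding relation_ideal_def
  by (rule ring.genideal_ideal[OF ring_bc_path_algebra relations_in_carrier])

lemma relations_in_relation_ideal:
  "relations_one \<Gamma> \<union> relations_two \<Gamma> \<union> relations_three \<Gamma> \<subseteq>
    (relation_ideal \<Gamma> :: (('a, 'l) bc_path \<Rightarrow>\<^sub>0 'k::field) set)"
  unfolding relation_ideal_def
  by (rule ring.genideal_self[OF ring_bc_path_algebra relations_in_carrier])

lemma relation_ideal_in_zero_ideal:
  "relation_ideal \<Gamma> \<subseteq> (zero_ideal :: (('a, 'l) bc_path \<Rightarrow>\<^sub>0 'k::field) set)"
  unfolding relation_ideal_def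
  using relations_one_in_zero_ideal relations_two_in_zero_ideal relations_three_in_zero_ideal
  by (intro ring.genideal_minimal[OF ring_bc_path_algebra ideal_zero_ideal]) blast

section \<open>Paths that vanish in the Brauer configuration algebra\<close>

lemma factor_in_relation_ideal:
  assumes "(path_elem (s, q, t) :: ('a, 'l) bc_path \<Rightarrow>\<^sub>0 'k::field) \<in> relation_ideal \<Gamma>"
    and "quiver.awalk u xs s" "quiver.awalk t ys v"
  shows "(path_elem (u, xs @ q @ ys, v) :: ('a, 'l) bc_path \<Rightarrow>\<^sub>0 'k) \<in> relation_ideal \<Gamma>"
proof -
  let ?R = "bc_path_algebra \<Gamma> :: (('a, 'l) bc_path \<Rightarrow>\<^sub>0 'k) ring"
  interpret ideal "relation_ideal \<Gamma>" ?R
    by (rule ideal_relation_ideal)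
  have "path_elem (u, xs, s) \<in> carrier ?R" "path_elem (t, ys, v) \<in> carrier ?R"
    using assms(2,3) by (simp_all add: quiver_paths_def)
  from I_l_closed[OF I_r_closed[OF assms(1) this(2)] this(1)] show ?thesis
    by (simp add: path_mult_singles)
qed

text \<open>Where consecutiveness first breaks down is immaterial: any adjacent pair that violates
  it is a type three relation, and the path is a multiple of that pair.\<close>

lemma nonconsecutive_in_relation_ideal:
  assumes "quiver.awalk u p v" "\<not> consecutive \<Gamma> p"
  shows "(path_elem (u, p, v) :: ('a, 'l) bc_path \<Rightarrow>\<^sub>0 'k::field) \<in> relation_ideal \<Gamma>"
proof -
  from assms(2) obtain i where i: "Suc i < length p" "p ! Suc i \<noteq> next_arrow \<Gamma> (p ! i)"
    by (auto simp: consecutive_def successively_conv_nth)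
  define a b where "a = p ! i" and "b = p ! Suc i"
  have p: "p = take i p @ [a, b] @ drop (Suc (Suc i)) p"
    using i(1) by (simp add: a_def b_def Cons_nth_drop_Suc)
  have "quiver.awalk u (take i p @ [a, b] @ drop (Suc (Suc i)) p) v"
    by (subst p[symmetric]) (rule assms(1))
  then obtain s t where walks: "quiver.awalk u (take i p) s" "quiver.awalk s [a, b] t"
      "quiver.awalk t (drop (Suc (Suc i)) p) v"
    unfolding quiver.awalk_append_iff by blast
  have neq: "b \<noteq> next_arrow \<Gamma> a"
    using i(2) by (simp add: a_def b_def)
  have "(path_elem (s, [a, b], t) :: ('a, 'l) bc_path \<Rightarrow>\<^sub>0 'k) \<in> relations_three \<Gamma>"
    unfolding relations_three_def
  proof (intro CollectI exI conjI notI refl)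
    show "(s, [a, b], t) \<in> quiver_paths (induced_quiver \<Gamma>)"
      using walks by (simp add: quiver_paths_def)
  next
    \<comment> \<open>A special cycle is a run, so any two adjacent arrows of it do follow one
      another.\<close>
    assume "\<exists>\<alpha>\<in>nontruncated \<Gamma>. \<exists>C\<in>special_cycles \<Gamma> \<alpha>. sublist [a, b] (fst (snd C))"
    then obtain \<alpha> l where "l < val \<Gamma> \<alpha>" "sublist [a, b] (run \<Gamma> \<alpha> l (val \<Gamma> \<alpha>))"
      by (auto simp: special_cycles_def special_cycle_eq_run)
    with consecutive_run[of \<Gamma> \<alpha> l "val \<Gamma> \<alpha>"] neq show False
      by (auto simp: sublist_def consecutive_def successively_append_iff)
  next
    assume "\<exists>\<alpha>\<in>nontruncated \<Gamma>. val \<Gamma> \<alpha> = 1 \<and> 1 < mu \<Gamma> \<alpha> \<and> a = (\<alpha>, 0) \<and> b = (\<alpha>, 0)"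
    with neq show False by (auto simp: next_arrow_def)
  qed (rule refl)
  then have "(path_elem (s, [a, b], t) :: ('a, 'l) bc_path \<Rightarrow>\<^sub>0 'k) \<in> relation_ideal \<Gamma>"
    using relations_in_relation_ideal by blast
  from factor_in_relation_ideal[OF this walks(1,3)] p show ?thesis by simp
qed

text \<open>The first \<open>mu \<Gamma> \<alpha> * val \<Gamma> \<alpha> + 1\<close> arrows form a
  type two relation, and the remaining arrows are a right factor. The strict bound provides the one
  extra arrow.\<close>

lemma long_run_in_relation_ideal:
  assumes "\<alpha> \<in> nontruncated \<Gamma>" "l < val \<Gamma> \<alpha>" "mu \<Gamma> \<alpha> * val \<Gamma> \<alpha> < n"
    and "quiver.awalk u (run \<Gamma> \<alpha> l n) v"
  shows "(path_elem (u, run \<Gamma> \<alpha> l n, v) :: ('a, 'l) bc_path \<Rightarrow>\<^sub>0 'k::field) \<in> relation_ideal \<Gamma>"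
proof -
  let ?R = "bc_path_algebra \<Gamma> :: (('a, 'l) bc_path \<Rightarrow>\<^sub>0 'k) ring"
  let ?m = "mu \<Gamma> \<alpha> * val \<Gamma> \<alpha>"
  let ?u = "orientation \<Gamma> \<alpha> ! l" and ?w = "orientation \<Gamma> \<alpha> ! (Suc l mod val \<Gamma> \<alpha>)"
  have "path_elem (special_cycle \<Gamma> \<alpha> l) [^]\<^bsub>?R\<^esub> mu \<Gamma> \<alpha>
      \<otimes>\<^bsub>?R\<^esub> path_elem (first_arrow \<Gamma> (special_cycle \<Gamma> \<alpha> l)) \<in> relations_two \<Gamma>"
    unfolding relations_two_def special_cycles_def using assms(1,2) by blast
  then have mem: "path_elem (?u, run \<Gamma> \<alpha> l (Suc ?m), ?w) \<in> (relation_ideal \<Gamma> :: (('a, 'l) bc_path \<Rightarrow>\<^sub>0 'k) set)"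
    using assms(1,2) relations_in_relation_ideal
    by (auto simp: special_cycle_power first_arrow_special_cycle path_mult_singles run_Suc)
  have run: "run \<Gamma> \<alpha> l n = run \<Gamma> \<alpha> l (Suc ?m) @ run \<Gamma> \<alpha> (l + Suc ?m) (n - Suc ?m)"
    using assms(3) run_add[of \<Gamma> \<alpha> l "Suc ?m" "n - Suc ?m"] by simp
  \<comment> \<open>Full turns do not move the position, so only the one additional arrow counts for
    the end.\<close>
  have walk: "quiver.awalk ?u (run \<Gamma> \<alpha> l (Suc ?m)) ?w"
    using awalk_run[OF assms(1,2), of "Suc ?m"] by (simp add: mod_simps flip: add_Suc)
  obtain s where s: "quiver.awalk u (run \<Gamma> \<alpha> l (Suc ?m)) s"
      "quiver.awalk s (run \<Gamma> \<alpha> (l + Suc ?m) (n - Suc ?m)) v"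
    using assms(4) unfolding run quiver.awalk_append_iff by blast
  have ends: "u = ?u" "s = ?w"
    using quiver.awalk_ends[OF s(1) walk] by auto
  have "quiver.awalk u [] ?u"
    unfolding ends using assms(1,2) by (simp add: quiver.awalk_Nil_iff orientation_in_polygons)
  from factor_in_relation_ideal[OF mem this s(2)[unfolded ends]] show ?thesis
    by (simp only: run append_Nil)
qed

text \<open>For distinct ends the monomial ideal and the relation ideal contain the same paths; this
  makes the short runs span as well as be independent.\<close>

lemma zero_walk_in_relation_ideal:
  assumes "(V, p, W) \<in> quiver_paths (induced_quiver \<Gamma>)" "V \<noteq> W" "zero_walk \<Gamma> p"
  shows "(path_elem (V, p, W) :: ('a, 'l) bc_path \<Rightarrow>\<^sub>0 'k::field) \<in> relation_ideal \<Gamma>"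
proof (cases "consecutive \<Gamma> p")
  case True
  from assms(1) have walk: "quiver.awalk V p W"
    by (simp add: quiver_paths_def)
  obtain \<alpha> l n
    where p: "p = run \<Gamma> \<alpha> l n" "\<alpha> \<in> nontruncated \<Gamma>" "l < val \<Gamma> \<alpha>" "n > 0"
      and ends: "V = orientation \<Gamma> \<alpha> ! l" "W = orientation \<Gamma> \<alpha> ! ((l + n) mod val \<Gamma> \<alpha>)"
    by (rule consecutive_walkE[OF walk True assms(2)])
  \<comment> \<open>A run of exactly this length makes full turns and returns to its start, contrary
    to \<open>V \<noteq> W\<close>. The length bound is therefore strict.\<close>
  from ends assms(2) p(3) have "n \<noteq> mu \<Gamma> \<alpha> * val \<Gamma> \<alpha>"
    by auto
  moreover have "mu \<Gamma> \<alpha> * val \<Gamma> \<alpha> \<le> n"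
    using assms(3) p by (simp add: zero_walk_run)
  ultimately show ?thesis
    using long_run_in_relation_ideal[OF p(2,3), of n V W] walk p(1) by simp
next
  case False
  then show ?thesis
    using assms(1) nonconsecutive_in_relation_ideal by (simp add: quiver_paths_def)
qed

section \<open>Dimensions in the Brauer configuration algebra\<close>

lemma ring_hom_residue_class:
  "ring_hom_ring (bc_path_algebra \<Gamma>) (brauer_algebra \<Gamma>)
    (residue_class \<Gamma> :: (('a, 'l) bc_path \<Rightarrow>\<^sub>0 'k::field) \<Rightarrow> _)"
proof -
  have "residue_class \<Gamma> = (\<lambda>f :: ('a, 'l) bc_path \<Rightarrow>\<^sub>0 'k. relation_ideal \<Gamma> +>\<^bsub>bc_path_algebra \<Gamma>\<^esub> f)"
    by (simp add: residue_class_def fun_eq_iff)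
  then show ?thesis
    unfolding brauer_algebra_def
    by (simp only: ideal.rcos_ring_hom_ring[OF ideal_relation_ideal])
qed

lemma residue_class_eq_iff:
  fixes f g :: "('a, 'l) bc_path \<Rightarrow>\<^sub>0 'k::field"
  assumes "Poly_Mapping.keys f \<subseteq> quiver_paths (induced_quiver \<Gamma>)"
    "Poly_Mapping.keys g \<subseteq> quiver_paths (induced_quiver \<Gamma>)"
  shows "residue_class \<Gamma> f = residue_class \<Gamma> g \<longleftrightarrow> f - g \<in> relation_ideal \<Gamma>"
  using ring.quotient_eq_iff_same_a_r_cos[OF ring_bc_path_algebra ideal_relation_ideal, of f g]
    quiver.path_algebra_minus(2)[OF finite_quiver_verts assms(2,1)] assms
  by (simp add: residue_class_def)

text \<open>Scaling is left multiplication by \<open>path_scalar\<close>, under which an ideal is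
  closed.\<close>

lemma single_in_relation_ideal:
  assumes "(path_elem x :: ('a, 'l) bc_path \<Rightarrow>\<^sub>0 'k::field) \<in> relation_ideal \<Gamma>"
    "x \<in> quiver_paths (induced_quiver \<Gamma>)"
  shows "(Poly_Mapping.single x c :: ('a, 'l) bc_path \<Rightarrow>\<^sub>0 'k) \<in> relation_ideal \<Gamma>"
proof -
  interpret ideal "relation_ideal \<Gamma>" "bc_path_algebra \<Gamma> :: (('a, 'l) bc_path \<Rightarrow>\<^sub>0 'k) ring"
    by (rule ideal_relation_ideal)
  obtain u p v where x: "x = (u, p, v)"
    by (cases x)
  have "u \<in> polygons \<Gamma>"
    using assms(2) quiver.awalk_hd_in_verts by (auto simp: x quiver_paths_def)
  then show ?thesis
    using I_l_closed[OF assms(1), of "path_scalar (induced_quiver \<Gamma>) c"] quiver.path_scalar_closed[of c]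
    by (simp add: x path_scalar_mult_left finite_polygons)
qed

text \<open>\<open>Span\<close> adds one line per list entry, which matches adding one path to the
  permitted support. Questions about spans in the quotient thereby become questions about supports
  in the path algebra.\<close>

lemma Span_residue_classes:
  assumes "set xs \<subseteq> quiver_paths (induced_quiver \<Gamma>)"
  shows "ring.Span (brauer_algebra \<Gamma>) (base_field \<Gamma>) (map (\<lambda>x. residue_class \<Gamma> (path_elem x)) xs)
    = residue_class \<Gamma> ` {f :: ('a, 'l) bc_path \<Rightarrow>\<^sub>0 'k::field. Poly_Mapping.keys f \<subseteq> set xs}"
proof -
  let ?R = "bc_path_algebra \<Gamma> :: (('a, 'l) bc_path \<Rightarrow>\<^sub>0 'k) ring"
  interpret hom: ring_hom_ring ?R "brauer_algebra \<Gamma>" "residue_class \<Gamma>"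
    by (rule ring_hom_residue_class)
  have combination: "residue_class \<Gamma> (path_scalar (induced_quiver \<Gamma>) c) \<otimes>\<^bsub>brauer_algebra \<Gamma>\<^esub>
      residue_class \<Gamma> (path_elem x) \<oplus>\<^bsub>brauer_algebra \<Gamma>\<^esub> residue_class \<Gamma> f
    = residue_class \<Gamma> (Poly_Mapping.single x c + f)"
    if "x \<in> quiver_paths (induced_quiver \<Gamma>)" "Poly_Mapping.keys f \<subseteq> quiver_paths (induced_quiver \<Gamma>)"
    for x c and f :: "('a, 'l) bc_path \<Rightarrow>\<^sub>0 'k"
  proof -
    obtain u p v where x: "x = (u, p, v)"
      by (cases x)
    have "u \<in> polygons \<Gamma>"
      using that(1) quiver.awalk_hd_in_verts by (auto simp: x quiver_paths_def)
    moreover have "path_scalar (induced_quiver \<Gamma>) c \<in> carrier ?R" "path_elem x \<in> carrier ?R" "f \<in> carrier ?R"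
      using that quiver.path_scalar_closed by auto
    moreover from this have "path_mult (path_scalar (induced_quiver \<Gamma>) c) (path_elem x) \<in> carrier ?R"
      using hom.R.m_closed by (metis path_algebra_simps(2))
    ultimately show ?thesis
      using hom.hom_mult[of "path_scalar (induced_quiver \<Gamma>) c" "path_elem x"]
        hom.hom_add[of "path_mult (path_scalar (induced_quiver \<Gamma>) c) (path_elem x)" f]
      by (simp add: x path_scalar_mult_left finite_polygons)
  qed
  show ?thesis
    using assms
  proof (induction xs)
    case Nil
    then show ?case using hom.hom_zero by simp
  next
    case (Cons x xs)
    let ?E = "residue_class \<Gamma> ` {f :: ('a, 'l) bc_path \<Rightarrow>\<^sub>0 'k. Poly_Mapping.keys f \<subseteq> set xs}"
    have "hom.S.line_extension (base_field \<Gamma>) (residue_class \<Gamma> (path_elem x)) ?E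
      = residue_class \<Gamma> ` {f. Poly_Mapping.keys f \<subseteq> set (x # xs)}" (is "?lhs = ?rhs")
    proof
      show "?lhs \<subseteq> ?rhs"
      proof
        fix y assume "y \<in> ?lhs"
        then obtain c f where y: "y = residue_class \<Gamma> (path_scalar (induced_quiver \<Gamma>) c)
            \<otimes>\<^bsub>brauer_algebra \<Gamma>\<^esub> residue_class \<Gamma> (path_elem x) \<oplus>\<^bsub>brauer_algebra \<Gamma>\<^esub> residue_class \<Gamma> f"
          and f: "Poly_Mapping.keys f \<subseteq> set xs"
          by (auto simp: hom.S.line_extension_mem_iff base_field_def)
        have "y = residue_class \<Gamma> (Poly_Mapping.single x c + f)"
          unfolding y using Cons.prems f by (intro combination) auto
        moreover have "Poly_Mapping.keys (Poly_Mapping.single x c + f) \<subseteq> set (x # xs)"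
          using keys_add[of "Poly_Mapping.single x c" f] f by (auto split: if_splits)
        ultimately show "y \<in> ?rhs" by blast
      qed
      show "?rhs \<subseteq> ?lhs"
      proof
        fix y assume "y \<in> ?rhs"
        then obtain f :: "('a, 'l) bc_path \<Rightarrow>\<^sub>0 'k"
          where f: "Poly_Mapping.keys f \<subseteq> set (x # xs)" and y: "y = residue_class \<Gamma> f"
          by blast
        \<comment> \<open>The coefficient of \<open>f\<close> at \<open>x\<close> is the scalar on
          the new line; what remains is supported on the tail.\<close>
        let ?c = "Poly_Mapping.lookup f x"
        let ?g = "f - Poly_Mapping.single x ?c"
        have g: "Poly_Mapping.keys ?g \<subseteq> set xs"
          using f by (auto simp: in_keys_iff lookup_minus lookup_single when_def split: if_splits)
        have "y = residue_class \<Gamma> (path_scalar (induced_quiver \<Gamma>) ?c)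
            \<otimes>\<^bsub>brauer_algebra \<Gamma>\<^esub> residue_class \<Gamma> (path_elem x) \<oplus>\<^bsub>brauer_algebra \<Gamma>\<^esub> residue_class \<Gamma> ?g"
          using combination[of x ?g ?c] Cons.prems subset_trans[OF g] by (simp add: y)
        with g show "y \<in> ?lhs"
          unfolding hom.S.line_extension_mem_iff base_field_def by blast
      qed
    qed
    then show ?case using Cons by simp
  qed
qed

text \<open>A dependence would put the difference of a path and a combination of later paths into
  the relation ideal, hence into \<open>zero_ideal\<close>. Its support would then consist of zero
  walks, but it contains a path that is none.\<close>

lemma independent_residue_classes:
  assumes "distinct xs"
    and "set xs \<subseteq> {(u, p, v). (u, p, v) \<in> quiver_paths (induced_quiver \<Gamma>) \<and> \<not> zero_walk \<Gamma> p}"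
  shows "ring.independent (brauer_algebra \<Gamma>) (base_field \<Gamma>)
    (map (\<lambda>x. residue_class \<Gamma> (path_elem x :: ('a, 'l) bc_path \<Rightarrow>\<^sub>0 'k::field)) xs)"
proof -
  let ?R = "bc_path_algebra \<Gamma> :: (('a, 'l) bc_path \<Rightarrow>\<^sub>0 'k) ring"
  interpret hom: ring_hom_ring ?R "brauer_algebra \<Gamma>" "residue_class \<Gamma>"
    by (rule ring_hom_residue_class)
  show ?thesis
    using assms
  proof (induction xs)
    case Nil
    then show ?case by (simp add: hom.S.independent.li_Nil)
  next
    case (Cons x xs)
    have xs: "set (x # xs) \<subseteq> quiver_paths (induced_quiver \<Gamma>)"
      using Cons.prems(2) by auto
    have "residue_class \<Gamma> (path_elem x) \<noteq> residue_class \<Gamma> f"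
      if "Poly_Mapping.keys f \<subseteq> set xs" for f :: "('a, 'l) bc_path \<Rightarrow>\<^sub>0 'k"
    proof
      assume "residue_class \<Gamma> (path_elem x) = residue_class \<Gamma> f"
      then have "path_elem x - f \<in> relation_ideal \<Gamma>"
        using xs that by (subst residue_class_eq_iff[symmetric]) auto
      then have "path_elem x - f \<in> zero_ideal"
        using relation_ideal_in_zero_ideal by blast
      \<comment> \<open>By distinctness \<open>f\<close> does not involve \<open>x\<close>, so
        nothing cancels its coefficient 1.\<close>
      moreover have "x \<in> Poly_Mapping.keys (path_elem x - f)"
      proof -
        have "x \<notin> Poly_Mapping.keys f"
          using that Cons.prems(1) by auto
        then show ?thesis
          by (simp add: in_keys_iff lookup_minus)
      qed
      ultimately show False
        using Cons.prems(2) by (auto simp: zero_ideal_def)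
    qed
    then have "residue_class \<Gamma> (path_elem x :: ('a, 'l) bc_path \<Rightarrow>\<^sub>0 'k) \<notin>
        hom.S.Span (base_field \<Gamma>) (map (\<lambda>x. residue_class \<Gamma> (path_elem x)) xs)"
      using xs by (subst Span_residue_classes) auto
    moreover have "residue_class \<Gamma> (path_elem x :: ('a, 'l) bc_path \<Rightarrow>\<^sub>0 'k) \<in> carrier (brauer_algebra \<Gamma>)"
      using xs by (intro hom.hom_closed) simp
    ultimately show ?case
      using Cons unfolding list.map by (intro hom.S.independent.li_Cons) auto
  qed
qed

section \<open>A basis of the space between two distinct polygons\<close>

definition basis_paths :: "('a, 'l) polygon \<Rightarrow> ('a, 'l) polygon \<Rightarrow> ('a, 'l) bc_path set" where
  "basis_paths V W = {(V, p, W) | p. (V, p, W) \<in> quiver_paths (induced_quiver \<Gamma>) \<and> \<not> zero_walk \<Gamma> p}"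

text \<open>The union of spans is first turned into the image of all combinations of paths between
  the two polygons. Terms at zero walks are then dropped, which does not change the class because
  such paths lie in the relation ideal.\<close>

lemma hom_space_eq:
  assumes "V \<noteq> W"
  shows "hom_space \<Gamma> V W = residue_class \<Gamma> `
    {f :: ('a, 'l) bc_path \<Rightarrow>\<^sub>0 'k::field. Poly_Mapping.keys f \<subseteq> basis_paths V W}"
proof -
  let ?P = "{(V, p, W) | p. (V, p, W) \<in> quiver_paths (induced_quiver \<Gamma>)}"
  let ?cls = "\<lambda>x. residue_class \<Gamma> (path_elem x :: ('a, 'l) bc_path \<Rightarrow>\<^sub>0 'k)"
  let ?I = "relation_ideal \<Gamma> :: (('a, 'l) bc_path \<Rightarrow>\<^sub>0 'k) set"
  interpret ideal ?I "bc_path_algebra \<Gamma>"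
    by (rule ideal_relation_ideal)
  have P: "?P \<subseteq> quiver_paths (induced_quiver \<Gamma>)" and B: "basis_paths V W \<subseteq> ?P"
    by (auto simp: basis_paths_def)
  have "{?cls (V, p, W) | p. (V, p, W) \<in> quiver_paths (induced_quiver \<Gamma>)} = ?cls ` ?P"
    by blast
  then have "hom_space \<Gamma> V W = (\<Union>xs\<in>lists ?P. ring.Span (brauer_algebra \<Gamma>) (base_field \<Gamma>) (map ?cls xs))"
    by (simp add: hom_space_def lists_image)
  also have "\<dots> = (\<Union>xs\<in>lists ?P. residue_class \<Gamma> ` {f. Poly_Mapping.keys f \<subseteq> set xs})"
    using P by (intro SUP_cong refl Span_residue_classes) auto
  also have "\<dots> = residue_class \<Gamma> ` {f. Poly_Mapping.keys f \<subseteq> ?P}"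
  proof -
    \<comment> \<open>Supports are finite, so each of them is enumerated by some list.\<close>
    have "{f. Poly_Mapping.keys f \<subseteq> ?P} =
        (\<Union>xs\<in>lists ?P. {f :: ('a, 'l) bc_path \<Rightarrow>\<^sub>0 'k. Poly_Mapping.keys f \<subseteq> set xs})" (is "?F = ?U")
    proof (intro equalityI subsetI)
      fix f assume "f \<in> ?F"
      moreover obtain xs where "set xs = Poly_Mapping.keys f"
        using finite_list[OF finite_keys[of f]] by blast
      ultimately show "f \<in> ?U"
        by (intro UN_I[of xs]) (simp_all add: lists_eq_set)
    next
      fix f assume "f \<in> ?U"
      then obtain xs where "set xs \<subseteq> ?P" "Poly_Mapping.keys f \<subseteq> set xs"
        unfolding lists_eq_set by blast
      then have "Poly_Mapping.keys f \<subseteq> ?P"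
        by (rule subset_trans[rotated])
      then show "f \<in> ?F"
        by (rule CollectI)
    qed
    then show ?thesis
      by (simp only: image_UN)
  qed
  also have "\<dots> = residue_class \<Gamma> ` {f. Poly_Mapping.keys f \<subseteq> basis_paths V W}"
  proof -
    have reduce: "\<exists>g. Poly_Mapping.keys g \<subseteq> basis_paths V W \<and> f - g \<in> ?I"
      if "Poly_Mapping.keys f \<subseteq> ?P" for f
      using that
    proof (induction f rule: poly_mapping_support_induct)
      case zero
      have "0 \<in> ?I"
        using additive_subgroup.zero_closed[OF additive_subgroup_axioms] by simp
      then show ?case by (intro exI[of _ 0]) simp
    next
      case (add x c f)
      then obtain g where g: "Poly_Mapping.keys g \<subseteq> basis_paths V W" "f - g \<in> ?I"
        by blast
      show ?case
      proof (cases "x \<in> basis_paths V W")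
        case True
        with g show ?thesis
          using keys_add[of "Poly_Mapping.single x c" g]
          by (intro exI[of _ "Poly_Mapping.single x c + g"]) (auto split: if_splits)
      next
        case False
        from add.hyps(1) obtain p where x: "x = (V, p, W)"
          and path: "(V, p, W) \<in> quiver_paths (induced_quiver \<Gamma>)"
          by blast
        with False have "zero_walk \<Gamma> p"
          by (simp add: basis_paths_def)
        with path assms have "path_elem (V, p, W) \<in> ?I"
          by (intro zero_walk_in_relation_ideal)
        then have "Poly_Mapping.single x c \<in> ?I"
          unfolding x using path by (rule single_in_relation_ideal)
        then have "Poly_Mapping.single x c + f - g \<in> ?I"
          using additive_subgroup.a_closed[OF additive_subgroup_axioms _ g(2)] by (simp add: add_diff_eq)
        with g(1) show ?thesis by blast
      qed
    qed
    have "residue_class \<Gamma> f \<in> residue_class \<Gamma> ` {f. Poly_Mapping.keys f \<subseteq> basis_paths V W}"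
      if f: "Poly_Mapping.keys f \<subseteq> ?P" for f :: "('a, 'l) bc_path \<Rightarrow>\<^sub>0 'k"
    proof -
      obtain g where g: "Poly_Mapping.keys g \<subseteq> basis_paths V W" "f - g \<in> ?I"
        using reduce[OF f] by blast
      then have "residue_class \<Gamma> f = residue_class \<Gamma> g"
        using f P B by (subst residue_class_eq_iff) auto
      with g(1) show ?thesis by blast
    qed
    moreover have "{f. Poly_Mapping.keys f \<subseteq> basis_paths V W} \<subseteq>
        {f :: ('a, 'l) bc_path \<Rightarrow>\<^sub>0 'k. Poly_Mapping.keys f \<subseteq> ?P}"
      using subset_trans[OF _ B] by (intro Collect_mono impI)
    ultimately show ?thesis
      by (intro equalityI image_mono image_subsetI) simp_all
  qed
  finally show ?thesis .
qed

section \<open>Counting the basis paths\<close>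

lemma card_positions:
  assumes "\<alpha> \<in> nontruncated \<Gamma>" "V \<in> polygons \<Gamma>"
  shows "card {l. l < val \<Gamma> \<alpha> \<and> orientation \<Gamma> \<alpha> ! l = V} = occ \<alpha> V"
proof -
  have "card {l. l < val \<Gamma> \<alpha> \<and> orientation \<Gamma> \<alpha> ! l = V} = length (filter ((=) V) (orientation \<Gamma> \<alpha>))"
    by (auto simp: length_filter_conv_card length_orientation[OF assms(1)] intro!: arg_cong[where f = card])
  also have "\<dots> = count (mset (orientation \<Gamma> \<alpha>)) V"
    by (simp add: count_mset count_list_eq_length_filter)
  finally show ?thesis
    using assms by (simp add: count_orientation)
qed

lemma finite_nontruncated: "finite (nontruncated \<Gamma>)"
  using finite_vertices by (simp add: nontruncated_def)

text \<open>Basis paths correspond to triples of a nontruncated vertex, a start position occupied by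
  \<open>V\<close>, and a length below \<open>mu \<Gamma> \<alpha> * val \<Gamma> \<alpha>\<close>
  that leads to \<open>W\<close>. The number of lengths is independent of the start, so the count is
  a product at each vertex.\<close>

lemma card_basis_paths:
  assumes "V \<in> polygons \<Gamma>" "W \<in> polygons \<Gamma>" "V \<noteq> W"
  shows "finite (basis_paths V W)"
    and "card (basis_paths V W) = (\<Sum>\<alpha>\<in>nontruncated \<Gamma>. mu \<Gamma> \<alpha> * occ \<alpha> V * occ \<alpha> W)"
proof -
  define L where "L \<alpha> = {l. l < val \<Gamma> \<alpha> \<and> orientation \<Gamma> \<alpha> ! l = V}" for \<alpha>
  define N where "N \<alpha> l = {n. n < mu \<Gamma> \<alpha> * val \<Gamma> \<alpha> \<and> orientation \<Gamma> \<alpha> ! ((l + n) mod val \<Gamma> \<alpha>) = W}" for \<alpha> l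
  define T where "T = (SIGMA \<alpha>:nontruncated \<Gamma>. SIGMA l:L \<alpha>. N \<alpha> l)"
  define h where "h = (\<lambda>(\<alpha>, l, n). (V, run \<Gamma> \<alpha> l n, W))"
  \<comment> \<open>Length 0 would give \<open>V = W\<close>. Positivity is essential for
    injectivity, since all runs of length 0 are the same empty list.\<close>
  have T: "\<alpha> \<in> nontruncated \<Gamma>" "l < val \<Gamma> \<alpha>" "orientation \<Gamma> \<alpha> ! l = V"
      "n < mu \<Gamma> \<alpha> * val \<Gamma> \<alpha>" "orientation \<Gamma> \<alpha> ! ((l + n) mod val \<Gamma> \<alpha>) = W" "n > 0"
    if "(\<alpha>, l, n) \<in> T" for \<alpha> l n
    using that assms(3) by (auto simp: T_def L_def N_def intro!: Nat.gr0I)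
  have "inj_on h T"
  proof (rule inj_onI)
    fix x y assume xy: "x \<in> T" "y \<in> T" "h x = h y"
    obtain \<alpha> l n \<beta> k m where x: "x = (\<alpha>, l, n)" and y: "y = (\<beta>, k, m)"
      by (cases x; cases y)
    from xy have mem: "(\<alpha>, l, n) \<in> T" "(\<beta>, k, m) \<in> T" and "h (\<alpha>, l, n) = h (\<beta>, k, m)"
      by (simp_all add: x y)
    then have eq: "run \<Gamma> \<alpha> l n = run \<Gamma> \<beta> k m"
      by (simp add: h_def)
    from arg_cong[OF eq, of length] have "n = m"
      by simp
    \<comment> \<open>The first arrow of a run records its vertex and its start position, which lies
      below the valency.\<close>
    moreover have "(\<alpha>, l) = (\<beta>, k)"
      using arg_cong[OF eq, of hd] T[OF mem(1)] T[OF mem(2)] by (simp add: hd_run)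
    ultimately show "x = y"
      by (simp add: x y)
  qed
  have image: "basis_paths V W = h ` T"
  proof
    show "h ` T \<subseteq> basis_paths V W"
    proof (rule image_subsetI)
      fix x assume "x \<in> T"
      moreover obtain \<alpha> l n where x: "x = (\<alpha>, l, n)"
        by (cases x)
      ultimately have "(\<alpha>, l, n) \<in> T"
        by simp
      note T = T[OF this]
      show "h x \<in> basis_paths V W"
        using run_in_quiver_paths[OF T(1,2), of n] T
        by (auto simp: x h_def basis_paths_def zero_walk_run)
    qed
    show "basis_paths V W \<subseteq> h ` T"
    proof
      fix x assume "x \<in> basis_paths V W"
      then obtain p where x: "x = (V, p, W)" and walk: "quiver.awalk V p W" and nz: "\<not> zero_walk \<Gamma> p"
        by (auto simp: basis_paths_def quiver_paths_def)
      from nz have "consecutive \<Gamma> p"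
        by (simp add: zero_walk_def)
      then obtain \<alpha> l n
        where p: "p = run \<Gamma> \<alpha> l n" "\<alpha> \<in> nontruncated \<Gamma>" "l < val \<Gamma> \<alpha>" "n > 0"
          and "V = orientation \<Gamma> \<alpha> ! l"
            "W = orientation \<Gamma> \<alpha> ! ((l + n) mod val \<Gamma> \<alpha>)"
        using consecutive_walkE[OF walk _ assms(3)] by metis
      moreover have "n < mu \<Gamma> \<alpha> * val \<Gamma> \<alpha>"
        using nz p by (simp add: zero_walk_run)
      ultimately have "(\<alpha>, l, n) \<in> T"
        by (simp add: T_def L_def N_def)
      then show "x \<in> h ` T"
        using p(1) by (intro image_eqI[of _ _ "(\<alpha>, l, n)"]) (simp_all add: h_def x)
    qed
  qed
  have fin: "finite (L \<alpha>)" "finite (N \<alpha> l)" for \<alpha> l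
    by (simp_all add: L_def N_def)
  then have "finite T"
    by (auto simp: T_def finite_nontruncated)
  then show "finite (basis_paths V W)"
    by (simp add: image)
  \<comment> \<open>The admissible lengths make up \<open>mu \<Gamma> \<alpha>\<close> full turns,
    each of which meets every occurrence of \<open>W\<close> once.\<close>
  have "card (N \<alpha> l) = mu \<Gamma> \<alpha> * occ \<alpha> W" if "\<alpha> \<in> nontruncated \<Gamma>" for \<alpha> l
    using card_periodic[where P = "\<lambda>i. orientation \<Gamma> \<alpha> ! i = W"]
    by (simp add: N_def card_positions[OF that assms(2)])
  moreover have "card (L \<alpha>) = occ \<alpha> V" if "\<alpha> \<in> nontruncated \<Gamma>" for \<alpha>
    unfolding L_def card_positions[OF that assms(1)] ..
  ultimately have "card T = (\<Sum>\<alpha>\<in>nontruncated \<Gamma>. mu \<Gamma> \<alpha> * occ \<alpha> V * occ \<alpha> W)"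
    using fin by (simp add: T_def finite_nontruncated ac_simps cong: sum.cong)
  then show "card (basis_paths V W) = (\<Sum>\<alpha>\<in>nontruncated \<Gamma>. mu \<Gamma> \<alpha> * occ \<alpha> V * occ \<alpha> W)"
    by (simp add: image card_image[OF \<open>inj_on h T\<close>])
qed

text \<open>Two distinct polygons each contribute at least 1 to the valency, which therefore exceeds
  1.\<close>

lemma common_vertex_nontruncated:
  assumes "V \<in> polygons \<Gamma>" "W \<in> polygons \<Gamma>" "V \<noteq> W" "\<alpha> \<in># snd V" "\<alpha> \<in># snd W"
  shows "\<alpha> \<in> nontruncated \<Gamma>"
proof -
  have "(\<Sum>X\<in>{V, W}. occ \<alpha> X) \<le> val \<Gamma> \<alpha>"
    unfolding val_def using assms finite_polygons by (intro sum_mono2) auto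
  moreover have "occ \<alpha> V > 0" "occ \<alpha> W > 0"
    using assms(4,5) by (simp_all add: occ_def)
  ultimately have "val \<Gamma> \<alpha> \<noteq> 1"
    using assms(3) by simp
  then show ?thesis
    using polygon_vertices[OF assms(1)] assms(4) by (auto simp: nontruncated_def truncated_def)
qed

end

theorem proposition3p2:
  fixes \<Gamma> :: "('a, 'l) brauer_config" and V W :: "('a, 'l) polygon"
    and \<Lambda> :: "(('a, 'l) bc_path \<Rightarrow>\<^sub>0 'k::field) set ring"
  assumes "brauer_configuration \<Gamma>"
    and "\<Lambda> = brauer_algebra \<Gamma>"
    and "V \<in> polygons \<Gamma>" and "W \<in> polygons \<Gamma>" and "V \<noteq> W"
  shows "ring.dimension \<Lambda>
           (\<Sum>\<alpha> \<in> (vertices \<Gamma> \<inter> set_mset (snd V)) \<inter> (vertices \<Gamma> \<inter> set_mset (snd W)).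
              mu \<Gamma> \<alpha> * occ \<alpha> V * occ \<alpha> W)
           (base_field \<Gamma>) (hom_space \<Gamma> V W)"
proof -
  interpret brauer_configuration \<Gamma>
    by (rule assms(1))
  let ?S = "(vertices \<Gamma> \<inter> set_mset (snd V)) \<inter> (vertices \<Gamma> \<inter> set_mset (snd W))"
  have "ring \<Lambda>"
    using ring_hom_residue_class unfolding assms(2) ring_hom_ring_def by blast
  obtain xs where xs: "set xs = basis_paths V W" "distinct xs"
    using finite_distinct_list[OF card_basis_paths(1)[OF assms(3-5)]] by blast
  let ?us = "map (\<lambda>x. residue_class \<Gamma> (path_elem x :: ('a, 'l) bc_path \<Rightarrow>\<^sub>0 'k)) xs"
  \<comment> \<open>The span of an independent list has the length of the list as its dimension;
    independence applies since no basis path is a zero walk.\<close>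
  have "ring.dimension \<Lambda> (length ?us) (base_field \<Gamma>) (ring.Span \<Lambda> (base_field \<Gamma>) ?us)"
    using xs unfolding assms(2)
    by (intro ring.dimension_independent[OF \<open>ring \<Lambda>\<close>[unfolded assms(2)]] independent_residue_classes)
      (auto simp: basis_paths_def)
  moreover have "ring.Span \<Lambda> (base_field \<Gamma>) ?us = hom_space \<Gamma> V W"
    unfolding assms(2) hom_space_eq[OF assms(5)] xs(1)[symmetric]
    using xs(1) by (intro Span_residue_classes) (auto simp: basis_paths_def)
  moreover have "length ?us = (\<Sum>\<alpha>\<in>nontruncated \<Gamma>. mu \<Gamma> \<alpha> * occ \<alpha> V * occ \<alpha> W)"
    using card_basis_paths(2)[OF assms(3-5)] distinct_card[OF xs(2)] xs(1) by simp
  \<comment> \<open>Common vertices are nontruncated, and at every other nontruncated vertex one of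
    the two occurrence numbers is 0.\<close>
  moreover have "\<dots> = (\<Sum>\<alpha>\<in>?S. mu \<Gamma> \<alpha> * occ \<alpha> V * occ \<alpha> W)"
  proof (rule sum.mono_neutral_right[OF finite_nontruncated])
    show "?S \<subseteq> nontruncated \<Gamma>"
      using common_vertex_nontruncated[OF assms(3-5)] by auto
    show "\<forall>\<alpha>\<in>nontruncated \<Gamma> - ?S. mu \<Gamma> \<alpha> * occ \<alpha> V * occ \<alpha> W = 0"
      by (auto simp: nontruncated_def occ_def not_in_iff)
  qed
  ultimately show ?thesis by simp
qed

end
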